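(* For $k\ge i\ge1$ and integers $N_1\ge N_2\ge\cdots\ge N_{k-1}\ge0$, there is a bijection $\Theta:\mathbb{G}_{N_1,\dots,N_{k-1};i}\to\mathbb{D}_{N_1}\times\mathbb{E}_{N_1,\dots,N_{k-1};i}$ such that whenever $\Theta(\mu)=(\eta,\nu)$ we have $|\mu|=|\eta|+|\nu|$.
   Context: An overpartition of $n$ is a partition of $n$ in which the first occurrence of each part size may be overlined. Parts are ordered by $\overline1<1<\overline2<2<\cdots$, and an overpartition is written $\lambda=(\lambda_1,\dots,\lambda_\ell)$ with $\lambda_1\le\cdots\le\lambda_\ell$ in this order; $|\lambda_j|$ is the numerical size of a part, $|\lambda|=\sum_j|\lambda_j|$. For $t\ge1$, $f_t(\lambda)$ (resp. $f_{\overline t}(\lambda)$) is the number of non-overlined (resp. overlined) parts equal to $t$; $f_0=f_{\overline0}=0$. Göllnitz–Gordon marking: marks are assigned to $\lambda_1,\dots,\lambda_\ell$ in this order; $\lambda_1$ gets mark $1$. For $p>1$: (a) a non-overlined odd $\lambda_p$ gets mark $1$; (b) an overlined even $\lambda_p$ gets mark $1$; (c) an overlined odd $\lambda_p$ gets the least positive integer not used as the mark of any $\lambda_j$ ($j<p$) with $|\lambda_p|-|\lambda_j|=1$; (d) if $\lambda_p=2t+2$ is non-overlined even, let $f$ be the least positive integer not used as the mark of any $\lambda_j$ ($j<p$) with $|\lambda_p|-|\lambda_j|\le2$, and $g$ the least positive integer used as the mark of some $\lambda_j$ ($j<p$) with $|\lambda_p|-|\lambda_j|=2$ ($g=0$ if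 none); if simultaneously (i) $g\ge2$, (ii) the mark of $\lambda_{p-1}$ is $g-1$, (iii) a non-overlined $2t+1$ or an $\overline{2t+2}$ occurs in $\lambda$, (iv) $\overline{2t+1}$ does not occur in $\lambda$, then $\lambda_p$ gets mark $g$, otherwise mark $f$. A part with mark $r$ is $r$-marked. $\mathbb{O}_{k,i}(m,n)$: overpartitions of $n$ with exactly $m$ parts such that (1) $f_{\overline1}+f_2\le i-1$; (2) $f_{\overline{2t}}+f_{2t}+f_{\overline{2t+1}}+f_{2t+2}\le k-1$ for all $t\ge0$; (3) for all $t\ge0$, $f_{2t+1}\ge1$ implies $f_{2t+2}\le k-2$. $\mathbb{F}_{k,i}(m,n)$: those $\lambda\in\mathbb{O}_{k,i}(m,n)$ whose smallest part is an overlined odd part or a non-overlined even part. $\mathbb{F}_{N_1,\dots,N_{k-1};i}$: the set of $\lambda\in\bigcup_{n}\mathbb{F}_{k,i}(N_1+\cdots+N_{k-1},n)$ having exactly $N_r$ $r$-marked parts for each $1\le r\le k-1$. $\mathbb{G}_{N_1,\dots,N_{k-1};i}$: those elements of $\mathbb{F}_{N_1,\dots,N_{k-1};i}$ with no overlined even parts and no non-overlined odd parts. $\mathbb{E}_{N_1,\dots,N_{k-1};i}$: those elements of $\mathbb{G}_{N_1,\dots,N_{k-1};i}$ with no overlined odd parts. For $N\ge0$, $\mathbb{D}_N$ is the set of partitions $\eta=(\eta_1<\cdots<\eta_\ell)$ into distinct negative odd integers in $[1-2N,-1]$, with $|\eta|=\eta_1+\cdots+\eta_\ell$ (so $\sum_{\eta\in\mathbb{D}_N}q^{|\eta|}=(-q^{1-2N};q^2)_N$).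 *)

theory Defs
  imports Main
begin

datatype part = Over nat | Plain nat

primrec psize :: "part \<Rightarrow> nat" where
  "psize (Over t) = t"
| "psize (Plain t) = t"

primrec overlined :: "part \<Rightarrow> bool" where
  "overlined (Over t) = True"
| "overlined (Plain t) = False"

definition part_le :: "part \<Rightarrow> part \<Rightarrow> bool" where
  "part_le x y \<longleftrightarrow>
     psize x < psize y \<or> (psize x = psize y \<and> (overlined x \<or> \<not> overlined y))"

text \<open>
  An overpartition is the weakly increasing list of its parts.  Since \<^term>\<open>Over t\<close>
  precedes \<^term>\<open>Plain t\<close>, allowing at most one \<^term>\<open>Over t\<close> says that only the
  first occurrence of a part size may be overlined.
\<close>

definition overpartition :: "part list \<Rightarrow> bool" where
  "overpartition l \<longleftrightarrow>
     sorted_wrt part_le l \<and> (\<forall>x \<in> set l. psize x \<ge> 1) \<and> (\<forall>t. count_list l (Over t) \<le> 1)"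

definition weight :: "part list \<Rightarrow> nat" where
  "weight l = sum_list (map psize l)"

definition f_plain :: "part list \<Rightarrow> nat \<Rightarrow> nat" where
  "f_plain l t = (if t = 0 then 0 else count_list l (Plain t))"

definition f_over :: "part list \<Rightarrow> nat \<Rightarrow> nat" where
  "f_over l t = (if t = 0 then 0 else count_list l (Over t))"

definition least_unused :: "nat set \<Rightarrow> nat" where
  "least_unused U = (LEAST r. r \<ge> 1 \<and> r \<notin> U)"

definition least_used :: "nat set \<Rightarrow> nat" where
  "least_used U = (if \<exists>r \<ge> 1. r \<in> U then LEAST r. r \<ge> 1 \<and> r \<in> U else 0)"

text \<open>
  \<open>gg_mark l p\<close> is the Goellnitz-Gordon mark of the part \<open>l ! p\<close>; positions count from 0.
  In the even plain case the part is \<open>s = 2t + 2\<close>, so \<open>2t + 1\<close> is \<open>s - 1\<close>.  All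
  differences of sizes are written additively; they are nonnegative because \<open>l\<close> is sorted.
\<close>

function gg_mark :: "part list \<Rightarrow> nat \<Rightarrow> nat" where
  "gg_mark l p =
    (if p = 0 then 1
     else case l ! p of
       Plain s \<Rightarrow>
         if odd s then 1
         else
           (let f = least_unused (gg_mark l ` {j \<in> {..<p}. s \<le> psize (l ! j) + 2});
                g = least_used (gg_mark l ` {j \<in> {..<p}. s = psize (l ! j) + 2})
            in if g \<ge> 2 \<and> gg_mark l (p - 1) = g - 1
                  \<and> (Plain (s - 1) \<in> set l \<or> Over s \<in> set l)
                  \<and> Over (s - 1) \<notin> set l
               then g else f)
     | Over s \<Rightarrow>
         if even s then 1
         else least_unused (gg_mark l ` {j \<in> {..<p}. s = psize (l ! j) + 1}))"
  by pat_completeness auto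
termination
  by (relation "measure snd") auto

declare gg_mark.simps [simp del]

definition O_set :: "nat \<Rightarrow> nat \<Rightarrow> nat \<Rightarrow> nat \<Rightarrow> part list set" where
  "O_set k i m n = {l. overpartition l \<and> weight l = n \<and> length l = m
     \<and> int (f_over l 1 + f_plain l 2) \<le> int i - 1
     \<and> (\<forall>t. int (f_over l (2*t) + f_plain l (2*t) + f_over l (2*t+1) + f_plain l (2*t+2))
              \<le> int k - 1)
     \<and> (\<forall>t. f_plain l (2*t+1) \<ge> 1 \<longrightarrow> int (f_plain l (2*t+2)) \<le> int k - 2)}"

text \<open>The empty overpartition has no smallest part and is admitted.\<close>

definition F_set :: "nat \<Rightarrow> nat \<Rightarrow> nat \<Rightarrow> nat \<Rightarrow> part list set" where
  "F_set k i m n = {l \<in> O_set k i m n. l \<noteq> [] \<longrightarrow>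
     (overlined (hd l) \<and> odd (psize (hd l))) \<or> (\<not> overlined (hd l) \<and> even (psize (hd l)))}"

text \<open>
  The sequence of the \<open>N\<^sub>r\<close> is a function \<open>N\<close> of which only the values
  \<open>N 1, \<dots>, N (k - 1)\<close> are used.
\<close>

definition F_marked :: "nat \<Rightarrow> nat \<Rightarrow> (nat \<Rightarrow> nat) \<Rightarrow> part list set" where
  "F_marked k i N = {l \<in> (\<Union>n. F_set k i (\<Sum>r = 1..k - 1. N r) n).
     \<forall>r \<in> {1..k - 1}. card {p. p < length l \<and> gg_mark l p = r} = N r}"

definition G_marked :: "nat \<Rightarrow> nat \<Rightarrow> (nat \<Rightarrow> nat) \<Rightarrow> part list set" where
  "G_marked k i N = {l \<in> F_marked k i N. \<forall>x \<in> set l.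
     \<not> (overlined x \<and> even (psize x)) \<and> \<not> (\<not> overlined x \<and> odd (psize x))}"

definition E_marked :: "nat \<Rightarrow> nat \<Rightarrow> (nat \<Rightarrow> nat) \<Rightarrow> part list set" where
  "E_marked k i N = {l \<in> G_marked k i N. \<forall>x \<in> set l. \<not> (overlined x \<and> odd (psize x))}"

definition D_set :: "nat \<Rightarrow> int list set" where
  "D_set M = {\<eta>. sorted_wrt (<) \<eta> \<and> (\<forall>x \<in> set \<eta>. odd x \<and> 1 - 2 * int M \<le> x \<and> x \<le> -1)}"

end

theory Submission
  imports Defs "HOL-Library.Multiset" "HOL-Computational_Algebra.Formal_Power_Series"
begin

text \<open>
  Both sides have finitely many elements of each weight, so it suffices to compare generating
  functions.  On the sets in question the marking is greedy: the marks at the sizes \<open>2t + 1\<close> and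
  \<open>2t + 2\<close> depend on the past only through the set \<open>A\<close> of marks occurring at size \<open>2t\<close>.  Let \<open>P\<^sub>A(n)\<close> and
  \<open>W\<^sub>A(n)\<close> be the generating functions of all continuations with mark multiset \<open>n\<close>, without and
  with odd parts; sizes are measured relative to \<open>2t\<close>.  With \<open>c\<close> the least mark outside \<open>A\<close>, the key identity is
  \[ P_A(n) = q^{2 n_1} ( P_{A - 1}(n) + q^2 P_{A + c}(n - c) ) \quad (1 \in A), \]
  proved together with a companion identity for \<open>1 \<notin> A\<close> by comparing coefficients, since removing one
  level lowers the weight.  It implies
  \[ W_A(n) = P_A(n) \prod_{j = 1}^{n_1} (1 + q^{1 - 2j}) \quad (1 \notin A), \]
  and the product is the generating function of \<open>D_set n\<^sub>1\<close>.
\<close>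

subsection \<open>Least unused marks\<close>

lemma least_unused_props:
  assumes "finite U"
  shows "1 \<le> least_unused U" "least_unused U \<notin> U"
proof -
  obtain r where "r \<ge> 1" "r \<notin> U"
    using ex_new_if_finite[of "insert 0 U"] assms by (metis finite.insertI infinite_UNIV_nat insert_iff less_one not_less)
  then have "1 \<le> least_unused U \<and> least_unused U \<notin> U"
    unfolding least_unused_def by (intro LeastI[of "\<lambda>r. 1 \<le> r \<and> r \<notin> U"]) auto
  then show "1 \<le> least_unused U" "least_unused U \<notin> U" by auto
qed

lemma below_least_unused: "\<lbrakk>1 \<le> r; r < least_unused U\<rbrakk> \<Longrightarrow> r \<in> U"
  unfolding least_unused_def using not_less_Least by blast

lemma least_unused_eqI:
  assumes "1 \<le> r" "r \<notin> U" "\<And>s. 1 \<le> s \<Longrightarrow> s < r \<Longrightarrow> s \<in> U"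
  shows "least_unused U = r"
  unfolding least_unused_def by (rule Least_equality) (use assms in \<open>auto simp: not_less[symmetric]\<close>)

lemma least_unused_gt_1: "\<lbrakk>finite U; 1 \<in> U\<rbrakk> \<Longrightarrow> 1 < least_unused U"
  using least_unused_props[of U] by (metis le_neq_implies_less)

lemma least_unused_1: "1 \<notin> U \<Longrightarrow> least_unused U = 1"
  by (rule least_unused_eqI) auto

lemma least_unused_less_insert:
  assumes "finite U" shows "least_unused U < least_unused (insert (least_unused U) U)"
proof (rule ccontr)
  let ?c = "least_unused U" let ?d = "least_unused (insert ?c U)"
  assume "\<not> ?c < ?d"
  moreover have d: "1 \<le> ?d" "?d \<notin> insert ?c U" using least_unused_props[of "insert ?c U"] assms by auto
  ultimately have "?d < ?c" by auto
  with below_least_unused[of ?d U] d show False by auto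
qed

declare One_nat_def [simp del]

subsection \<open>Generating functions of the even continuations\<close>

text \<open>A level with parts left to place carries a positive power of \<open>fps_X\<close>, which
  gains one order of divisibility; this drives the inductions on \<open>w\<close>.\<close>

lemma fps_X_power_Suc_dvd:
  fixes F :: "int fps"
  assumes "fps_X ^ w dvd F" "0 < m"
  shows "fps_X ^ Suc w dvd fps_X ^ m * F"
  using mult_dvd_mono[OF le_imp_power_dvd[of 1 m fps_X] assms(1)] assms(2) by simp

lemma fps_eq_0_if_X_power_dvd:
  fixes F :: "int fps"
  assumes "\<And>w. fps_X ^ w dvd F"
  shows "F = 0"
proof (rule fps_ext)
  fix j
  obtain G where "F = fps_X ^ Suc j * G" using assms by blast
  then show "fps_nth F j = fps_nth 0 j" by (simp only: fps_X_power_mult_nth) simp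
qed

text \<open>
  \<open>U\<close> is the set of marks blocked for the next part \<open>2t + 2\<close>, \<open>B\<close> the set of marks already given to
  parts \<open>2t + 2\<close>, \<open>N\<close> the marks still to be distributed; \<open>K B N\<close> accounts for stopping at this size
  and moving on to larger parts.
\<close>

function level_sum :: "(nat set \<Rightarrow> nat multiset \<Rightarrow> int fps) \<Rightarrow> nat set \<Rightarrow> nat set \<Rightarrow> nat multiset \<Rightarrow> int fps" where
  "level_sum K U B N = K B N +
     (if least_unused U \<in># N
      then level_sum K (insert (least_unused U) U) (insert (least_unused U) B) (N - {#least_unused U#})
      else 0)"
  by pat_completeness auto
termination
  by (relation "measure (\<lambda>(K, U, B, N). size N)") (auto simp: size_Diff1_less)

declare level_sum.simps [simp del]

text \<open>The algebra needs nothing of the lists but this recursion. At \<open>{#}\<close> the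
  recursion only says that the value does not depend on \<open>A\<close>, so \<open>P_0\<close> has
  to fix it.\<close>

locale even_gf =
  fixes P :: "nat set \<Rightarrow> nat multiset \<Rightarrow> int fps"
  assumes P_rec: "finite A \<Longrightarrow> P A n = fps_X ^ (2 * size n) * level_sum P A {} n"
    and P_0: "finite A \<Longrightarrow> P A {#} = 1"
begin

text \<open>
  \<open>P A n\<close> counts the sequences of plain even parts with mark multiset \<open>n\<close> when the parts of
  size \<open>0\<close> are pretended to carry the marks in \<open>A\<close>.  Both defects below vanish: unfolding one level
  writes each of them as \<open>X ^ (2 * size n)\<close> times a sum of defects for smaller multisets and of the
  defect of \<open>{}\<close> for \<open>n\<close> itself, so divisibility by \<open>X ^ w\<close> of all of them implies divisibility by
  \<open>X ^ Suc w\<close>.  For empty \<open>B\<close> the junk value \<open>Min {}\<close> is harmless.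
\<close>

definition defect_with_1 :: "nat set \<Rightarrow> nat multiset \<Rightarrow> int fps" where
  "defect_with_1 A n = P A n - fps_X ^ (2 * count n 1) * (P (A - {1}) n
     + fps_X ^ 2 * (if least_unused A \<in># n
         then P (insert (least_unused A) A) (n - {#least_unused A#}) else 0))"

definition defect_without_1 :: "nat set \<Rightarrow> nat multiset \<Rightarrow> int fps" where
  "defect_without_1 B m = P B m - fps_X ^ (2 * count m 1) *
     ((if 1 \<in># m then P (insert 1 B) (m - {#1#}) else 0) + P (B - {Min B}) m)"

text \<open>The marks joined to \<open>B\<close> exceed all its elements, so \<open>Min B\<close>
  survives along the chain and the congruences for \<open>defect_without_1\<close> add up term by
  term. For empty \<open>B\<close> the first joined mark would become the minimum, hence
  \<open>B \<noteq> {}\<close>.\<close>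

lemma level_sum_dvd_without_1:
  assumes defect_without_1: "\<And>B m. finite B \<Longrightarrow> \<forall>x\<in>B. 1 < x \<Longrightarrow> fps_X ^ w dvd defect_without_1 B m"
  assumes "finite A" "1 \<in> A" "finite B" "B \<noteq> {}" "\<forall>x\<in>B. 1 < x" "\<forall>x\<in>B. x < least_unused A"
  shows "fps_X ^ w dvd level_sum P A B n - fps_X ^ (2 * count n 1) *
     ((if 1 \<in># n then level_sum P A (insert 1 B) (n - {#1#}) else 0) + level_sum P A (B - {Min B}) n)"
  using assms(2-)
proof (induction "size n" arbitrary: n A B rule: less_induct)
  case less
  define c where "c = least_unused A"
  have c: "1 < c" "c \<notin> A" "c < least_unused (insert c A)" "c \<notin> B"
    using least_unused_gt_1[of A] least_unused_props[of A] least_unused_less_insert[of A] less.prems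
    unfolding c_def by blast+
  note rec = level_sum.simps[of P A, folded c_def]
  have mn: "Min (insert c B) = Min B"
  proof -
    have "Min B < c" using less.prems Min_in[of B] unfolding c_def by blast
    then show ?thesis using less.prems by (subst Min_insert) auto
  qed
  have mB: "insert c (B - {Min B}) = insert c B - {Min B}" 
    using less.prems c by (metis Min_in insert_Diff_if singletonD)
  have swap: "insert c (insert 1 B) = insert 1 (insert c B)" by auto
  have swap2: "n - {#1#} - {#c#} = n - {#c#} - {#1#}" by (simp add: diff_diff_add_mset add_mset_commute)
  show ?case
  proof (cases "c \<in># n")
    case False
    then have "c \<notin># n - {#1#}" by (meson in_diffD)
    then show ?thesis using False defect_without_1[of B n] less.prems unfolding rec defect_without_1_def by auto
  next
    case True
    let ?n = "n - {#c#}" 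
    have IH: "fps_X ^ w dvd level_sum P (insert c A) (insert c B) ?n - fps_X ^ (2 * count n 1) *
     ((if 1 \<in># n then level_sum P (insert c A) (insert 1 (insert c B)) (?n - {#1#}) else 0)
       + level_sum P (insert c A) (insert c B - {Min B}) ?n)"
    proof -
      have "\<forall>x\<in>insert c B. x < least_unused (insert c A)"
        using less.prems c unfolding c_def[symmetric] by auto
      then show ?thesis
        using less.hyps[of ?n "insert c A" "insert c B"] less.prems c True mn
        by (simp add: size_Diff1_less in_diff_count)
    qed
    have "c \<in># n - {#1#}" using True c by (simp add: in_diff_count)
    with dvd_add[OF IH defect_without_1[of B n]] less.prems True show ?thesis
      unfolding rec[of B n] rec[of "insert 1 B"] rec[of "B - {Min B}"] defect_without_1_def mB swap swap2
      by (auto simp: algebra_simps)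
  qed
qed

lemma level_sum_dvd_with_1:
  assumes defect_with_1: "\<And>A n. finite A \<Longrightarrow> 1 \<in> A \<Longrightarrow> fps_X ^ w dvd defect_with_1 A n"
  assumes "finite U" "finite A" "1 \<in> A" "1 \<in> U" "c = least_unused A" "c < least_unused U"
  shows "fps_X ^ w dvd level_sum P U A n - fps_X ^ (2 * count n 1) *
     (level_sum P U (A - {1}) n + fps_X ^ 2 * (if c \<in># n then level_sum P U (insert c A) (n - {#c#}) else 0))"
  using assms(2-)
proof (induction "size n" arbitrary: n U A rule: less_induct)
  case less
  define d where "d = least_unused U"
  have d: "1 < d" "d \<notin> U" "d < least_unused (insert d U)" "c < d"
    using least_unused_gt_1 least_unused_props least_unused_less_insert less.prems unfolding d_def by auto
  note rec = level_sum.simps[of P U, folded d_def]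
  have c: "1 \<le> c" "c \<notin> A" using less.prems least_unused_props by auto
  have lA: "least_unused (insert d A) = c"
    by (rule least_unused_eqI) (use c d less.prems below_least_unused in auto)
  have swap: "insert d (insert c A) = insert c (insert d A)" "insert d (A - {1}) = insert d A - {1}" using d by auto
  have swap2: "n - {#c#} - {#d#} = n - {#d#} - {#c#}" by (simp add: diff_diff_add_mset add_mset_commute)
  show ?case
  proof (cases "d \<in># n")
    case False
    then have "d \<notin># n - {#c#}" by (meson in_diffD)
    then show ?thesis using False defect_with_1[of A n] less.prems unfolding rec defect_with_1_def by auto
  next
    case True
    let ?n = "n - {#d#}" 
    have IH: "fps_X ^ w dvd level_sum P (insert d U) (insert d A) ?n - fps_X ^ (2 * count n 1) *
     (level_sum P (insert d U) (insert d A - {1}) ?n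
       + fps_X ^ 2 * (if c \<in># n then level_sum P (insert d U) (insert c (insert d A)) (?n - {#c#}) else 0))"
      using less.hyps[of ?n "insert d U" "insert d A"] less.prems d True lA
      by (auto simp: size_Diff1_less d_def[symmetric] in_diff_count)
    have "d \<in># n - {#c#}" using True d by (simp add: in_diff_count)
    with dvd_add[OF IH defect_with_1[of A n]] less.prems True show ?thesis
      unfolding rec[of A n] rec[of "insert c A"] rec[of "A - {1}"] defect_with_1_def swap swap2
      by (auto simp: algebra_simps)
  qed
qed

text \<open>The gap \<open>f + 1\<close> filled by the correction term of
  \<open>defect_with_1\<close> is also the mark that \<open>U - {c}\<close> offers next. Hence the
  corrections form the chain under \<open>U - {c}\<close> without its first term, until
  \<open>f + 1\<close> reaches \<open>c\<close>.\<close>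

lemma level_sum_dvd_interval:
  assumes defect_with_1: "\<And>A n. finite A \<Longrightarrow> 1 \<in> A \<Longrightarrow> fps_X ^ w dvd defect_with_1 A n"
  assumes "finite U" "c \<in> U" "1 \<le> f" "f < c" "U \<inter> {1..c} = insert c {1..f}"
  shows "fps_X ^ w dvd level_sum P U {1..f} n - fps_X ^ (2 * count n 1) * (level_sum P U ({1..f} - {1}) n
     + fps_X ^ 2 * (level_sum P (U - {c}) {1..f} n - P {1..f} n))"
  using assms(2-)
proof (induction "size n" arbitrary: n U f rule: less_induct)
  case less
  define d where "d = Suc f"
  let ?A = "{1..f}"
  have sub: "x \<in> U \<longleftrightarrow> x = c \<or> x \<le> f" if "1 \<le> x" "x \<le> c" for x
    using less.prems(5) that by (auto simp: set_eq_iff)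
  have lV: "least_unused (U - {c}) = d"
    by (rule least_unused_eqI) (use sub less.prems in \<open>auto simp: d_def\<close>)
  have lA: "least_unused ?A = d"
    by (rule least_unused_eqI) (auto simp: d_def)
  have ins: "insert d ?A = {1..d}" "insert d (?A - {1}) = {1..d} - {1}" using less.prems by (auto simp: d_def)
  show ?case
  \<comment> \<open>At this point \<open>U\<close> skips \<open>c\<close>, while
    \<open>U - {c}\<close> takes it and thereby becomes \<open>U\<close>; the rest is
    \<open>level_sum_dvd_with_1\<close>.\<close>
  proof (cases "d = c")
    case True
    have "\<not> least_unused U \<le> c"
      using least_unused_props[of U] sub[of "least_unused U"] less.prems(1) True unfolding d_def by linarith
    then have "c < least_unused U" by simp
    moreover have "insert c (U - {c}) = U" using less.prems by auto
    moreover have "1 \<in> U" using sub[of 1] less.prems by auto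
    ultimately show ?thesis
      using level_sum_dvd_with_1[OF defect_with_1, of U ?A c n] less.prems lA True
      by (auto simp: lV level_sum.simps[of P "U - {c}"] split: if_splits)
  next
    case False
    then have dc: "d < c" using less.prems by (simp add: d_def)
    have lU: "least_unused U = d"
      by (rule least_unused_eqI) (use sub dc less.prems in \<open>auto simp: d_def\<close>)
    have insd: "insert d U - {c} = insert d (U - {c})" using dc by auto
    show ?thesis
    proof (cases "d \<in># n")
      case False
      then show ?thesis
        using defect_with_1[of ?A n] less.prems
        by (simp add: level_sum.simps[of P U] level_sum.simps[of P "U - {c}"] lU lV lA defect_with_1_def)
    next
      case True
      let ?n = "n - {#d#}"
      have "insert d U \<inter> {1..c} = insert c {1..d}"
      proof -
        have "insert d U \<inter> {1..c} = insert d (U \<inter> {1..c})" using dc by (auto simp: d_def)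
        also have "\<dots> = insert c (insert d {1..f})" using less.prems by auto
        finally show ?thesis using ins by simp
      qed
      then have IH: "fps_X ^ w dvd level_sum P (insert d U) {1..d} ?n - fps_X ^ (2 * count ?n 1) * (level_sum P (insert d U) ({1..d} - {1}) ?n
          + fps_X ^ 2 * (level_sum P (insert d U - {c}) {1..d} ?n - P {1..d} ?n))"
        using less.prems dc True by (intro less.hyps) (auto intro: size_Diff1_less simp: d_def)
      have "count ?n 1 = count n 1" using less.prems by (simp add: d_def)
      with IH have "fps_X ^ w dvd level_sum P (insert d U) {1..d} ?n - fps_X ^ (2 * count n 1) * (level_sum P (insert d U) ({1..d} - {1}) ?n
          + fps_X ^ 2 * (level_sum P (insert d (U - {c})) {1..d} ?n - P {1..d} ?n))"
        by (simp only: insd)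
      from dvd_add[OF this defect_with_1[of ?A n]] True less.prems show ?thesis
        by (simp add: level_sum.simps[of P U _ n] level_sum.simps[of P "U - {c}" _ n] lU lV lA defect_with_1_def ins algebra_simps)
    qed
  qed
qed

text \<open>The gap of \<open>A\<close> is the very mark joined next, so the correction terms are
  the same chain without its first term.\<close>

lemma level_sum_dvd_diagonal:
  assumes defect_with_1: "\<And>A n. finite A \<Longrightarrow> 1 \<in> A \<Longrightarrow> fps_X ^ w dvd defect_with_1 A n"
  assumes "finite A" "1 \<in> A"
  shows "fps_X ^ w dvd level_sum P A A n - fps_X ^ (2 * count n 1) * (level_sum P A (A - {1}) n
     + fps_X ^ 2 * (level_sum P A A n - P A n))"
  using assms(2-)
proof (induction "size n" arbitrary: n A rule: less_induct)
  case less
  define d where "d = least_unused A"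
  have d: "1 < d" using least_unused_gt_1 less.prems unfolding d_def by auto
  note rec = level_sum.simps[of P A, folded d_def]
  show ?case
  proof (cases "d \<in># n")
    case False
    then show ?thesis using defect_with_1[of A n] less.prems unfolding rec defect_with_1_def d_def by simp
  next
    case True
    let ?n = "n - {#d#}"
    have IH: "fps_X ^ w dvd level_sum P (insert d A) (insert d A) ?n - fps_X ^ (2 * count n 1) *
      (level_sum P (insert d A) (insert d A - {1}) ?n
        + fps_X ^ 2 * (level_sum P (insert d A) (insert d A) ?n - P (insert d A) ?n))"
      using less.hyps[of ?n "insert d A"] True less.prems d by (auto simp: size_Diff1_less)
    have eq: "insert d (A - {1}) = insert d A - {1}" using d by auto
    from dvd_add[OF IH defect_with_1[of A n]] less.prems True show ?thesis
      unfolding rec[of _ n] defect_with_1_def d_def[symmetric] eq by (simp add: algebra_simps)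
  qed
qed


text \<open>Both \<open>A\<close> and \<open>A - {1}\<close> are unfolded by one level. From
  \<open>A - {1}\<close> the first part gets mark 1, after which \<open>A\<close> is blocked again,
  so the two chains compare as in \<open>defect_without_1\<close>.\<close>

lemma defect_with_1_dvd:
  assumes defect_without_1: "\<And>B m. finite B \<Longrightarrow> \<forall>x\<in>B. 1 < x \<Longrightarrow> fps_X ^ w dvd defect_without_1 B m"
  assumes "finite A" "1 \<in> A"
  shows "fps_X ^ Suc w dvd defect_with_1 A n"
proof (cases "n = {#}")
  case True
  then show ?thesis using assms by (simp add: defect_with_1_def P_0)
next
  case False
  define c where "c = least_unused A"
  have c: "1 < c" "c \<notin> A" "c < least_unused (insert c A)"
    using least_unused_gt_1[of A] least_unused_props[of A] least_unused_less_insert[of A] assms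
    unfolding c_def by blast+
  have l1: "least_unused (A - {1}) = 1" by (simp add: least_unused_1)
  have insA: "insert 1 (A - {1}) = A" "insert 1 {c} = insert c {1}" using assms by auto
  have swap2: "n - {#1#} - {#c#} = n - {#c#} - {#1#}" by (simp add: diff_diff_add_mset add_mset_commute)
  have in1: "c \<in># n - {#1#} \<longleftrightarrow> c \<in># n" "1 \<in># n - {#c#} \<longleftrightarrow> 1 \<in># n" "count (n - {#c#}) 1 = count n 1"
    using c by (auto simp: in_diff_count)
  \<comment> \<open>The factor \<open>fps_X ^ 2\<close> is absorbed: \<open>n - {#c#}\<close> has
    one part less and contributes an exponent smaller by 2.\<close>
  let ?F = "level_sum P A {} n - fps_X ^ (2 * count n 1) * (level_sum P (A - {1}) {} n
     + (if c \<in># n then level_sum P (insert c A) {} (n - {#c#}) else 0))"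
  have "fps_X ^ w dvd ?F"
  proof (cases "c \<in># n")
    case False
    then show ?thesis using defect_without_1[of "{}" n] l1 insA in1
      by (auto simp: level_sum.simps[of P A] level_sum.simps[of P "A - {1}"] c_def[symmetric] defect_without_1_def algebra_simps)
  next
    case True
    \<comment> \<open>The term that stops at once is split off, since the lemma needs a nonempty
      set; the defect of \<open>{}\<close> settles it.\<close>
    have "fps_X ^ w dvd level_sum P (insert c A) {c} (n - {#c#}) - fps_X ^ (2 * count n 1) *
     ((if 1 \<in># n then level_sum P (insert c A) (insert c {1}) (n - {#c#} - {#1#}) else 0) + level_sum P (insert c A) {} (n - {#c#}))"
    proof -
      have sing: "{c} - {Min {c}} = {}" by simp
      have "fps_X ^ w dvd level_sum P (insert c A) {c} (n - {#c#}) - fps_X ^ (2 * count (n - {#c#}) 1) *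
        ((if 1 \<in># n - {#c#} then level_sum P (insert c A) (insert 1 {c}) (n - {#c#} - {#1#}) else 0)
          + level_sum P (insert c A) ({c} - {Min {c}}) (n - {#c#}))"
        by (rule level_sum_dvd_without_1[OF defect_without_1]) (use assms(2,3) c in auto)
      then show ?thesis by (simp only: in1 insA sing)
    qed
    from dvd_add[OF this defect_without_1[of "{}" n]] True show ?thesis
      unfolding level_sum.simps[of P A _ n] level_sum.simps[of P "A - {1}"] level_sum.simps[of P A "{1}"] c_def[symmetric] l1 insA in1 swap2 defect_without_1_def
      by (auto simp: algebra_simps)
  qed
  moreover have "defect_with_1 A n = fps_X ^ (2 * size n) * ?F"
  proof (cases "c \<in># n")
    case True
    then have "2 * size n = 2 + 2 * size (n - {#c#})" using size_Suc_Diff1[OF True] by simp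
    then have "fps_X ^ 2 * P (insert c A) (n - {#c#}) = fps_X ^ (2 * size n) * level_sum P (insert c A) {} (n - {#c#})"
      using assms by (simp only: P_rec finite_insert power_add mult.assoc)
    then show ?thesis using assms True P_rec[of A n] P_rec[of "A - {1}" n] unfolding defect_with_1_def c_def[symmetric]
      by (simp add: algebra_simps)
  next
    case False
    then show ?thesis using assms P_rec[of A n] P_rec[of "A - {1}" n] unfolding defect_with_1_def c_def[symmetric]
      by (simp add: algebra_simps)
  qed
  ultimately show ?thesis using False
    by (metis fps_X_power_Suc_dvd nonempty_has_size nat_0_less_mult_iff zero_less_numeral)
qed

text \<open>Here the first part of a level always gets mark 1. The chains then run under
  \<open>insert 1 B\<close> with or without \<open>Min B\<close>, as in the interval lemma, and
  stopping at once leaves the defect of \<open>{}\<close> for the same \<open>m\<close>.\<close>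

lemma defect_without_1_dvd:
  assumes defect_with_1: "\<And>A n. finite A \<Longrightarrow> 1 \<in> A \<Longrightarrow> fps_X ^ w dvd defect_with_1 A n"
    and defect_without_1: "\<And>B m. finite B \<Longrightarrow> \<forall>x\<in>B. 1 < x \<Longrightarrow> fps_X ^ w dvd defect_without_1 B m"
  assumes B: "finite B" "\<forall>x\<in>B. 1 < x"
  shows "fps_X ^ Suc w dvd defect_without_1 B m"
proof (cases "m = {#}")
  case True
  then show ?thesis using assms by (simp add: defect_without_1_def P_0)
next
  case False
  define c where "c = Min B"
  have lB: "least_unused B = 1" "least_unused (B - {c}) = 1" using B by (auto intro!: least_unused_1)
  obtain F where F: "fps_X ^ w dvd F" "defect_without_1 B m = fps_X ^ (2 * size m) * F"
  proof (cases "1 \<in># m")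
    \<comment> \<open>The only mark offered is 1, so no part of size 2 is possible, and
      \<open>B\<close> and \<open>B - {c}\<close> unfold to the same series.\<close>
    case False
    then have "count m 1 = 0" by (simp add: not_in_iff)
    with False have "defect_without_1 B m = 0" using B P_rec[of B m] P_rec[of "B - {c}" m]
      by (simp add: defect_without_1_def c_def[symmetric] level_sum.simps[of P B] level_sum.simps[of P "B - {c}"] lB)
    then show ?thesis using that[of 0] by simp
  next
    case True
    define n where "n = m - {#1#}"
    have cnt: "count m 1 = Suc (count n 1)" "size m = Suc (size n)"
      using True size_Suc_Diff1[of 1 m] by (auto simp: n_def)
    let ?H = "level_sum P (insert 1 B) {1} n - fps_X ^ (2 * count n 1) * (level_sum P (insert 1 B) {} n
     + fps_X ^ 2 * (level_sum P (insert 1 (B - {c})) {1} n - P {1} n))"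
    have "fps_X ^ w dvd ?H"
    proof (cases "B = {}")
      \<comment> \<open>For empty \<open>B\<close> also \<open>B - {c}\<close> is empty, whatever
        \<open>c\<close> is, so both chains run under \<open>{1}\<close>.\<close>
      case True
      then show ?thesis using level_sum_dvd_diagonal[OF defect_with_1, of "{1}" n] by simp
    next
      case False
      then have c: "c \<in> B" "\<And>x. x \<in> B \<Longrightarrow> c \<le> x" using B by (auto simp: c_def)
      with B have "1 < c" by blast
      moreover have "insert 1 B \<inter> {1..c} = insert c {1}" using c \<open>1 < c\<close> by (auto dest: c(2))
      moreover have "insert 1 B - {c} = insert 1 (B - {c})" using \<open>1 < c\<close> by auto
      ultimately show ?thesis using level_sum_dvd_interval[OF defect_with_1, of "insert 1 B" c 1 n] B c by simp
    qed
    then have "fps_X ^ w dvd ?H + defect_without_1 {} m" using defect_without_1 by simp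
    moreover have "defect_without_1 B m = fps_X ^ (2 * size m) * (?H + defect_without_1 {} m)"
      using B True unfolding defect_without_1_def P_rec[OF B(1)] P_rec[OF finite_Diff[OF B(1)]] P_rec[OF finite.insertI[OF B(1)]]
         c_def[symmetric] level_sum.simps[of P B] level_sum.simps[of P "B - {c}"] lB
      by (simp add: n_def[symmetric] cnt algebra_simps power_add power2_eq_square)
    ultimately show ?thesis using that by blast
  qed
  then show ?thesis using False
    by (metis fps_X_power_Suc_dvd nonempty_has_size nat_0_less_mult_iff zero_less_numeral)
qed

lemma defect_with_1_eq_0:
  assumes "finite A" "1 \<in> A"
  shows "defect_with_1 A n = 0"
proof (rule fps_eq_0_if_X_power_dvd)
  fix w
  have "(\<forall>A n. finite A \<longrightarrow> 1 \<in> A \<longrightarrow> fps_X ^ w dvd defect_with_1 A n) \<and>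
    (\<forall>B m. finite B \<longrightarrow> (\<forall>x\<in>B. 1 < x) \<longrightarrow> fps_X ^ w dvd defect_without_1 B m)"
  proof (induction w)
    case (Suc w)
    then have IH: "\<And>A n. finite A \<Longrightarrow> 1 \<in> A \<Longrightarrow> fps_X ^ w dvd defect_with_1 A n"
      "\<And>B m. finite B \<Longrightarrow> \<forall>x\<in>B. 1 < x \<Longrightarrow> fps_X ^ w dvd defect_without_1 B m" by auto
    show ?case by (intro conjI allI impI defect_with_1_dvd defect_without_1_dvd IH)
  qed simp
  then show "fps_X ^ w dvd defect_with_1 A n" using assms by blast
qed

end

subsection \<open>Adding the overlined odd parts\<close>

lemma Suc_square: "(Suc n)\<^sup>2 = n\<^sup>2 + (2 * n + 1)" 
  by (simp add: power2_eq_square)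

locale full_gf = even_gf +
  fixes W :: "nat set \<Rightarrow> nat multiset \<Rightarrow> int fps"
  assumes W_rec: "finite A \<Longrightarrow> W A n = fps_X ^ (2 * size n) * level_sum W A {} n
      + (if least_unused A \<in># n
         then fps_X ^ (2 * size n - 1) * level_sum W (insert (least_unused A) A) {} (n - {#least_unused A#})
         else 0)"
    and W_0: "finite A \<Longrightarrow> W A {#} = 1"
begin

text \<open>This is the product of \<open>1 + q^(1 - 2j)\<close> for \<open>j = 1, ..., n\<close>
  times \<open>q^(n^2)\<close>, the power that clears the negative exponents.\<close>

definition odd_prod :: "nat \<Rightarrow> int fps" where
  "odd_prod n = (\<Prod>j<n. 1 + fps_X ^ (2 * j + 1))"

lemma odd_prod_Suc: "odd_prod (Suc n) = odd_prod n * (1 + fps_X ^ (2 * n + 1))"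
  by (simp add: odd_prod_def)

text \<open>
  In Laurent form, \<open>W M N = (\<Prod>j<count N 1. 1 + X ^ (- 2 j - 1)) * P M N\<close> if \<open>1 \<notin> M\<close>.  If \<open>1 \<in> M\<close>, the
  cluster of the 1-marked part in the initial level may still acquire an odd part, which gives
  the extra summand.
\<close>

definition defect_full :: "nat set \<Rightarrow> nat multiset \<Rightarrow> int fps" where
  "defect_full M N = fps_X ^ ((count N 1)\<^sup>2) * W M N - odd_prod (count N 1) * (P M N +
     (if 1 \<in> M \<and> least_unused M \<in># N
      then fps_X * P (insert (least_unused M) M) (N - {#least_unused M#}) else 0))"

text \<open>The joined marks are larger than 1, so the number of marks 1 to be placed is constant
  and the extra summand of \<open>defect_full\<close> never occurs.\<close>

lemma level_sum_full_dvd_without_1: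
  assumes defect_full: "\<And>M N. finite M \<Longrightarrow> fps_X ^ w dvd defect_full M N"
  assumes "finite U" "finite B" "1 \<in> U" "1 \<notin> B"
  shows "fps_X ^ w dvd fps_X ^ ((count N 1)\<^sup>2) * level_sum W U B N - odd_prod (count N 1) * level_sum P U B N"
  using assms(2-)
proof (induction "size N" arbitrary: N U B rule: less_induct)
  case less
  define c where "c = least_unused U"
  have c: "1 < c" using least_unused_gt_1 less.prems unfolding c_def by auto
  note rec = level_sum.simps[of _ U, folded c_def]
  have D: "fps_X ^ w dvd fps_X ^ ((count N 1)\<^sup>2) * W B N - odd_prod (count N 1) * P B N"
    using defect_full[of B N] less.prems by (simp add: defect_full_def)
  show ?case
  proof (cases "c \<in># N")
    case False
    then show ?thesis using D by (simp add: rec)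
  next
    case True
    have "fps_X ^ w dvd fps_X ^ ((count (N - {#c#}) 1)\<^sup>2) * level_sum W (insert c U) (insert c B) (N - {#c#})
      - odd_prod (count (N - {#c#}) 1) * level_sum P (insert c U) (insert c B) (N - {#c#})"
      using less.prems c True by (intro less.hyps) (auto intro: size_Diff1_less)
    moreover have "count (N - {#c#}) 1 = count N 1" using c by simp
    ultimately show ?thesis using dvd_add[OF D] True unfolding rec[of _ B N] by (fastforce simp: algebra_simps)
  qed
qed

text \<open>The factor \<open>1 + fps_X ^ (2 * count N 1 + 1)\<close> is the one
  \<open>odd_prod\<close> gains with one more mark 1. The extra summand in the defect of
  \<open>A\<close> supplies the second summand of the key identity, which merges
  \<open>P (A - {1})\<close> into \<open>P A\<close>.\<close>

lemma level_sum_full_dvd_with_1: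
  assumes defect_full: "\<And>M N. finite M \<Longrightarrow> fps_X ^ w dvd defect_full M N"
  assumes "finite U" "finite A" "1 \<in> U" "1 \<in> A"
  shows "fps_X ^ w dvd fps_X ^ ((count N 1)\<^sup>2) *
      (fps_X ^ (2 * count N 1 + 1) * level_sum W U A N + fps_X ^ (2 * count N 1) * level_sum W U (A - {1}) N)
    - odd_prod (count N 1) * (1 + fps_X ^ (2 * count N 1 + 1)) * level_sum P U A N"
  using assms(2-)
proof (induction "size N" arbitrary: N U A rule: less_induct)
  case less
  define c where "c = least_unused U"
  have c: "1 < c" using least_unused_gt_1 less.prems unfolding c_def by auto
  note rec = level_sum.simps[of _ U, folded c_def]
  let ?n = "count N 1"
  have D: "fps_X ^ w dvd fps_X ^ (?n\<^sup>2) *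
      (fps_X ^ (2 * ?n + 1) * W A N + fps_X ^ (2 * ?n) * W (A - {1}) N)
    - odd_prod ?n * (1 + fps_X ^ (2 * ?n + 1)) * P A N" (is "_ dvd ?D")
  proof -
    define T where "T = (if least_unused A \<in># N
         then P (insert (least_unused A) A) (N - {#least_unused A#}) else 0)"
    have PA: "P A N = fps_X ^ (2 * ?n) * (P (A - {1}) N + fps_X ^ 2 * T)"
      using defect_with_1_eq_0[of A N] less.prems by (simp add: defect_with_1_def T_def)
    have DA: "defect_full A N = fps_X ^ (?n\<^sup>2) * W A N - odd_prod ?n * (P A N + fps_X * T)"
      using less.prems by (simp add: defect_full_def T_def)
    have DA': "defect_full (A - {1}) N = fps_X ^ (?n\<^sup>2) * W (A - {1}) N - odd_prod ?n * P (A - {1}) N"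
      by (simp add: defect_full_def)
    \<comment> \<open>Read \<open>y\<close> as \<open>fps_X ^ (?n\<^sup>2)\<close>, \<open>x\<close>
      as \<open>fps_X ^ (2 * ?n)\<close> and \<open>z\<close> as \<open>fps_X\<close>; the last
      bracket vanishes by \<open>PA\<close>.\<close>
    have alg: "y * (x * z * a + x * b) - r * (1 + x * z) * p = x * z * (y * a - r * (p + z * t))
        + x * (y * b - r * p') + r * (x * (p' + z\<^sup>2 * t) - p)" for x y z a b r p p' t :: "int fps"
      by (simp add: algebra_simps power2_eq_square)
    have "?D = fps_X ^ (2 * ?n + 1) * defect_full A N + fps_X ^ (2 * ?n) * defect_full (A - {1}) N
      + odd_prod ?n * (fps_X ^ (2 * ?n) * (P (A - {1}) N + fps_X ^ 2 * T) - P A N)"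
      unfolding DA DA' power_add power_one_right by (rule alg)
    also have "\<dots> = fps_X ^ (2 * ?n + 1) * defect_full A N + fps_X ^ (2 * ?n) * defect_full (A - {1}) N"
      by (simp only: PA[symmetric] diff_self mult_zero_right add_0_right)
    finally have eq: "?D = \<dots>" .
    show ?thesis unfolding eq by (intro dvd_add dvd_mult defect_full finite_Diff less.prems)
  qed
  show ?case
  proof (cases "c \<in># N")
    case False
    then show ?thesis using D by (simp add: rec)
  next
    case True
    have cn: "count (N - {#c#}) 1 = ?n" and ins: "insert c (A - {1}) = insert c A - {1}" using c by auto
    let ?N = "N - {#c#}"
    have "fps_X ^ w dvd fps_X ^ ((count ?N 1)\<^sup>2) *
      (fps_X ^ (2 * count ?N 1 + 1) * level_sum W (insert c U) (insert c A) ?N + fps_X ^ (2 * count ?N 1) * level_sum W (insert c U) (insert c A - {1}) ?N)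
    - odd_prod (count ?N 1) * (1 + fps_X ^ (2 * count ?N 1 + 1)) * level_sum P (insert c U) (insert c A) ?N" (is "_ dvd ?E")
      using less.prems c True by (intro less.hyps) (auto intro: size_Diff1_less)
    from dvd_add[OF D this[unfolded cn]] show ?thesis using True unfolding rec[of _ _ N] ins
      by (simp add: algebra_simps)
  qed
qed

text \<open>If \<open>1 \<in> M\<close>, the extra summand matches the branch of
  \<open>W_rec\<close> with an overlined part. Otherwise the next mark is 1, and placing it on a
  plain or on an overlined part gives the two summands of the preceding lemma.\<close>

lemma defect_full_dvd:
  assumes defect_full: "\<And>M N. finite M \<Longrightarrow> fps_X ^ w dvd defect_full M N"
  assumes M: "finite M"
  shows "fps_X ^ Suc w dvd defect_full M N"
proof (cases "N = {#}")
  case True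
  then show ?thesis using M by (simp add: defect_full_def P_0 W_0 odd_prod_def)
next
  case False
  let ?n = "count N 1"
  define c where "c = least_unused M"
  have sz: "0 < 2 * size N" "0 < 2 * size N - 1" using False by (auto simp: nonempty_has_size)
  show ?thesis
  proof (cases "1 \<in> M")
    case True
    have c: "1 < c" using least_unused_gt_1 M True unfolding c_def by auto
    let ?F = "\<lambda>U N. fps_X ^ ((count N 1)\<^sup>2) * level_sum W U {} N - odd_prod (count N 1) * level_sum P U {} N"
    have F: "fps_X ^ w dvd ?F U N" if "finite U" "1 \<in> U" for U N using level_sum_full_dvd_without_1[OF defect_full] that by simp
    have "defect_full M N = fps_X ^ (2 * size N) * ?F M N + fps_X ^ (2 * size N - 1) *
      (if c \<in># N then ?F (insert c M) (N - {#c#}) else 0)"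
    proof (cases "c \<in># N")
      case True
      have "2 * size N - 1 = Suc (2 * size (N - {#c#}))" using size_Suc_Diff1[OF True] by simp
      then have "fps_X * P (insert c M) (N - {#c#}) = fps_X ^ (2 * size N - 1) * level_sum P (insert c M) {} (N - {#c#})"
        using M by (simp only: P_rec finite_insert power_Suc mult.assoc)
      moreover have "count (N - {#c#}) 1 = ?n" using c by simp
      ultimately show ?thesis using M True \<open>1 \<in> M\<close> P_rec[of M N] W_rec[of M N]
        unfolding defect_full_def c_def[symmetric] by (simp add: algebra_simps)
    next
      case False
      then show ?thesis using M P_rec[of M N] W_rec[of M N]
        unfolding defect_full_def c_def[symmetric] by (simp add: algebra_simps)
    qed
    moreover have "fps_X ^ w dvd (if c \<in># N then ?F (insert c M) (N - {#c#}) else 0)"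
      using F[of "insert c M" "N - {#c#}"] M True by (simp only: finite_insert insertI2 dvd_0_right simp_thms split: if_split)
    ultimately show ?thesis
      using dvd_add[OF fps_X_power_Suc_dvd[OF F[OF M True] sz(1)] fps_X_power_Suc_dvd[OF _ sz(2)]]
      by (simp only:)
  next
    case False
    then have lM: "least_unused M = 1" by (simp add: least_unused_1)
    show ?thesis
    proof (cases "1 \<in># N")
      case False
      then have "defect_full M N = fps_X ^ (2 * size N) * defect_full {} N"
        using M \<open>1 \<notin> M\<close> P_rec[of M N] W_rec[of M N]
        by (simp add: defect_full_def lM level_sum.simps[of _ M] algebra_simps)
      then show ?thesis using fps_X_power_Suc_dvd[OF defect_full sz(1)] by simp
    next
      case True
      let ?N = "N - {#1#}" let ?m = "count ?N 1" let ?U = "insert 1 M"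
      have n: "?n = Suc ?m" using True by simp
      \<comment> \<open>The set \<open>{1}\<close> belongs to a plain part 2 with mark 1,
        \<open>{1} - {1}\<close> to an overlined part 1, whose mark the next level does not
        see.\<close>
      let ?G = "fps_X ^ (?m\<^sup>2) * (fps_X ^ (2 * ?m + 1) * level_sum W ?U {1} ?N + fps_X ^ (2 * ?m) * level_sum W ?U ({1} - {1}) ?N)
        - odd_prod ?m * (1 + fps_X ^ (2 * ?m + 1)) * level_sum P ?U {1} ?N"
      have "fps_X ^ w dvd ?G" by (rule level_sum_full_dvd_with_1[OF defect_full]) (use M in auto)
      then have "fps_X ^ w dvd defect_full {} N + ?G" using defect_full by (intro dvd_add) auto
      moreover have "defect_full M N = fps_X ^ (2 * size N) * (defect_full {} N + ?G)"
      proof -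
        have "2 * size N = Suc (2 * size N - 1)" using sz by simp
        then have s: "fps_X ^ (2 * size N) = fps_X * fps_X ^ (2 * size N - 1)" for fps_X :: "int fps" by (metis power_Suc)
        have W: "W M N = fps_X ^ (2 * size N) * (W {} N + level_sum W ?U {1} ?N) + fps_X ^ (2 * size N - 1) * level_sum W ?U {} ?N"
          using M True W_rec[of M N] by (simp add: lM level_sum.simps[of W M])
        have P: "P M N = fps_X ^ (2 * size N) * (P {} N + level_sum P ?U {1} ?N)"
          using M True P_rec[of M N] by (simp add: lM level_sum.simps[of P M])
        \<comment> \<open>The odd factor \<open>fps_X\<close> lifts the exponent
          \<open>2 * size N - 1\<close> of the overlined branch to
          \<open>2 * size N\<close>.\<close>
        have sq: "fps_X ^ (?n\<^sup>2) = fps_X ^ (?m\<^sup>2) * fps_X ^ (2 * ?m) * fps_X" for fps_X :: "int fps"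
          unfolding n Suc_square power_add by simp
        have "fps_X ^ (?n\<^sup>2) * W M N - odd_prod ?n * P M N = fps_X ^ (2 * size N) * (fps_X ^ (?n\<^sup>2) * W {} N - odd_prod ?n * P {} N + ?G)"
          unfolding W P sq unfolding n odd_prod_Suc unfolding s power_add power_one_right
          by (simp add: algebra_simps)
        then show ?thesis using \<open>1 \<notin> M\<close> by (simp add: defect_full_def)
      qed
      ultimately show ?thesis using fps_X_power_Suc_dvd[OF _ sz(1)] by metis
    qed
  qed
qed

lemma defect_full_eq_0:
  assumes "finite M"
  shows "defect_full M N = 0"
proof (rule fps_eq_0_if_X_power_dvd)
  fix w
  have "\<forall>M N. finite M \<longrightarrow> fps_X ^ w dvd defect_full M N"
  proof (induction w)
    case (Suc w)
    then have IH: "\<And>M N. finite M \<Longrightarrow> fps_X ^ w dvd defect_full M N" by auto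
    show ?case by (intro allI impI defect_full_dvd IH)
  qed simp
  then show "fps_X ^ w dvd defect_full M N" using assms by blast
qed

end

subsection \<open>Overpartitions and their weights\<close>

definition weight_gf :: "part list set \<Rightarrow> int fps" where
  "weight_gf S = Abs_fps (\<lambda>n. int (card {l \<in> S. weight l = n}))"

lemma finite_overpartitions: "finite {l. overpartition l \<and> weight l = n}"
proof (rule finite_subset)
  show "{l. overpartition l \<and> weight l = n} \<subseteq> {l. set l \<subseteq> Over ` {..n} \<union> Plain ` {..n} \<and> length l \<le> n}"
  proof safe
    fix l assume l: "overpartition l" "n = weight l"
    have "\<forall>x\<in>set l. 1 \<le> psize x" using l(1) by (simp add: overpartition_def)
    then show "length l \<le> weight l" by (induction l) (auto simp: weight_def)
    fix x assume "x \<in> set l" "x \<notin> Plain ` {..weight l}"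
    moreover from this have "psize x \<le> weight l"
      unfolding weight_def by (simp add: member_le_sum_list)
    ultimately show "x \<in> Over ` {..weight l}" by (cases x rule: part.exhaust) auto
  qed
  show "finite {l. set l \<subseteq> Over ` {..n} \<union> Plain ` {..n} \<and> length l \<le> n}"
    by (rule finite_lists_length_le) auto
qed

lemma finite_weight_fibre:
  assumes "S \<subseteq> Collect overpartition" shows "finite {l \<in> S. weight l = n}"
  by (rule finite_subset[OF _ finite_overpartitions[of n]]) (use assms in auto)

lemma weight_gf_Un:
  assumes "S \<inter> T = {}" "S \<subseteq> Collect overpartition" "T \<subseteq> Collect overpartition"
  shows "weight_gf (S \<union> T) = weight_gf S + weight_gf T"
proof (rule fps_ext)
  fix n
  have "{l \<in> S \<union> T. weight l = n} = {l \<in> S. weight l = n} \<union> {l \<in> T. weight l = n}" by auto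
  then show "fps_nth (weight_gf (S \<union> T)) n = fps_nth (weight_gf S + weight_gf T) n"
    using assms by (simp add: weight_gf_def card_Un_disjoint finite_weight_fibre disjoint_iff)
qed

lemma weight_gf_image:
  assumes "inj_on h S" "\<And>l. l \<in> S \<Longrightarrow> weight (h l) = weight l + k"
  shows "weight_gf (h ` S) = fps_X ^ k * weight_gf S"
proof (rule fps_ext)
  fix n
  have "{l \<in> h ` S. weight l = n} = (if n < k then {} else h ` {l \<in> S. weight l = n - k})"
    using assms(2) by (auto simp: image_iff)
  moreover have "inj_on h {l \<in> S. weight l = n - k}" using assms(1) by (rule inj_on_subset) auto
  ultimately show "fps_nth (weight_gf (h ` S)) n = fps_nth (fps_X ^ k * weight_gf S) n"
    by (simp add: weight_gf_def fps_X_power_mult_nth card_image)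
qed

text \<open>The shape of the lists in \<open>G_marked\<close> (\<open>b\<close> true) and in
  \<open>E_marked\<close> (\<open>b\<close> false); the flag lets both share one
  decomposition.\<close>

definition gg_list :: "bool \<Rightarrow> part list \<Rightarrow> bool" where
  "gg_list b l \<longleftrightarrow> overpartition l \<and>
     (\<forall>x\<in>set l. if overlined x then b \<and> odd (psize x) else even (psize x))"

lemma overpartition_Nil [simp]: "overpartition []"
  by (simp add: overpartition_def)

lemma overpartition_Cons:
  "overpartition (x # l) \<longleftrightarrow> overpartition l \<and> (\<forall>y\<in>set l. part_le x y) \<and> 1 \<le> psize x
     \<and> (overlined x \<longrightarrow> x \<notin> set l)"
proof -
  have "(\<forall>t. count_list (x # l) (Over t) \<le> 1) \<longleftrightarrow>
    (\<forall>t. count_list l (Over t) \<le> 1) \<and> (overlined x \<longrightarrow> count_list l x = 0)"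
  proof (cases x)
    case (Over s)
    have "count_list (x # l) (Over t) \<le> 1 \<longleftrightarrow> (if t = s then count_list l x = 0 else count_list l (Over t) \<le> 1)" for t
      using Over by (simp add: One_nat_def)
    then show ?thesis using Over by (metis le0 overlined.simps(1))
  qed simp
  then show ?thesis by (auto simp: overpartition_def count_list_0_iff)
qed

lemma gg_list_Nil [simp]: "gg_list b []"
  by (simp add: gg_list_def)

lemma gg_list_Cons:
  "gg_list b (x # l) \<longleftrightarrow> gg_list b l \<and> (\<forall>y\<in>set l. part_le x y) \<and> 1 \<le> psize x
     \<and> (overlined x \<longrightarrow> x \<notin> set l) \<and> (if overlined x then b \<and> odd (psize x) else even (psize x))"
  by (auto simp: gg_list_def overpartition_Cons)

lemma gg_list_size: "gg_list b l \<Longrightarrow> x \<in> set l \<Longrightarrow> 1 \<le> psize x"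
  by (simp add: gg_list_def overpartition_def)

lemma gg_list_cases:
  assumes "gg_list b l" "x \<in> set l"
  shows "x = Over 1 \<or> x = Plain 2 \<or> 3 \<le> psize x"
proof -
  have "1 \<le> psize x" "if overlined x then odd (psize x) else even (psize x)"
    using assms by (auto simp: gg_list_def overpartition_def)
  moreover have "t = 1 \<or> 3 \<le> t" if "odd t" for t :: nat using that by presburger
  moreover have "t = 2 \<or> 3 \<le> t" if "even t" "1 \<le> t" for t :: nat using that by presburger
  ultimately show ?thesis by (cases x) simp_all
qed

lemma gg_list_Cons_Over1:
  "gg_list b (Over 1 # l) \<longleftrightarrow> b \<and> gg_list b l \<and> Over 1 \<notin> set l"
proof -
  have "part_le (Over 1) y" if "gg_list b l" "y \<in> set l" for y
    using gg_list_cases[OF that] by (auto simp: part_le_def)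
  then show ?thesis by (simp add: gg_list_Cons) blast
qed

lemma gg_list_Cons_Plain2:
  "gg_list b (Plain 2 # l) \<longleftrightarrow> gg_list b l \<and> Over 1 \<notin> set l"
proof -
  have "part_le (Plain 2) y \<longleftrightarrow> y \<noteq> Over 1" if "gg_list b l" "y \<in> set l" for y
    using gg_list_cases[OF that] by (auto simp: part_le_def)
  then show ?thesis by (simp add: gg_list_Cons) blast
qed

lemma gg_list_Over1_first:
  assumes "gg_list b l" "Over 1 \<in> set l"
  shows "\<exists>l'. l = Over 1 # l'"
proof (cases l)
  case (Cons x l')
  have "part_le x (Over 1) \<or> x = Over 1" "1 \<le> psize x" "x \<in> set l"
    using assms Cons by (auto simp: gg_list_Cons)
  then have "x = Over 1" using gg_list_cases[OF assms(1), of x] by (auto simp: part_le_def)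
  then show ?thesis using Cons by auto
qed (use assms in auto)

lemma gg_list_Plain2_first:
  assumes "gg_list b l" "Over 1 \<notin> set l" "Plain 2 \<in> set l"
  shows "\<exists>l'. l = Plain 2 # l'"
proof (cases l)
  case (Cons x l')
  have "part_le x (Plain 2) \<or> x = Plain 2" "1 \<le> psize x" "x \<in> set l" "x \<noteq> Over 1"
    using assms Cons by (auto simp: gg_list_Cons)
  then have "x = Plain 2" using gg_list_cases[OF assms(1), of x] by (auto simp: part_le_def)
  then show ?thesis using Cons by auto
qed (use assms in auto)

section \<open>Passing to the next level by raising all sizes by two\<close>

primrec shift2 :: "part \<Rightarrow> part" where
  "shift2 (Over t) = Over (t + 2)"
| "shift2 (Plain t) = Plain (t + 2)"

lemma shift2_simps [simp]:
  "psize (shift2 x) = psize x + 2" "overlined (shift2 x) = overlined x"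
  "part_le (shift2 x) (shift2 y) = part_le x y" "shift2 x = shift2 y \<longleftrightarrow> x = y"
  by (cases x; cases y; simp add: part_le_def)+

lemma inj_map_shift2: "inj_on (map shift2) S"
  by (rule inj_on_subset[OF inj_mapI]) (auto simp: inj_def)

lemma gg_list_map_shift2:
  assumes "\<forall>x\<in>set l. 1 \<le> psize x"
  shows "gg_list b (map shift2 l) \<longleftrightarrow> gg_list b l"
  using assms by (induction l) (auto simp: gg_list_Cons)

lemma gg_list_eq_map_shift2:
  assumes "gg_list b l" "Over 1 \<notin> set l" "Plain 2 \<notin> set l"
  obtains l' where "gg_list b l'" "l = map shift2 l'"
proof -
  define l' where "l' = map (case_part (\<lambda>t. Over (t - 2)) (\<lambda>t. Plain (t - 2))) l"
  \<comment> \<open>Hence the subtractions in \<open>l'\<close> are not truncated and leave positive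
    sizes.\<close>
  have big: "3 \<le> psize x" if "x \<in> set l" for x using gg_list_cases[OF assms(1) that] assms that by auto
  have "shift2 (case x of Over t \<Rightarrow> Over (t - 2) | Plain t \<Rightarrow> Plain (t - 2)) = x" if "x \<in> set l" for x
    using big[OF that] by (cases x) auto
  then have eq: "map shift2 l' = l" by (simp add: l'_def map_idI)
  moreover have "\<forall>x\<in>set l'. 1 \<le> psize x" using big eq by fastforce
  ultimately show ?thesis using that gg_list_map_shift2[of l' b] assms by auto
qed

lemma weight_map_shift2: "weight (map shift2 l) = weight l + 2 * length l"
  by (induction l) (auto simp: weight_def)

subsection \<open>Greedy marking relative to a context\<close>

primrec near :: "part \<Rightarrow> nat \<Rightarrow> bool" where
  "near (Over s) j \<longleftrightarrow> s = j + 1"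
| "near (Plain s) j \<longleftrightarrow> s \<le> j + 2"

text \<open>
  A context is a set of pairs (size, mark) of parts that were placed earlier.  On lists without
  plain odd and overlined even parts, clause (d) of the marking always assigns \<open>f\<close>, so that every mark
  is the least one not visible.
\<close>

definition visible :: "(nat \<times> nat) set \<Rightarrow> part \<Rightarrow> nat set" where
  "visible C x = {r. \<exists>s. (s, r) \<in> C \<and> near x s}"

primrec marks :: "(nat \<times> nat) set \<Rightarrow> part list \<Rightarrow> nat list" where
  "marks C [] = []"
| "marks C (x # l) = least_unused (visible C x) # marks (insert (psize x, least_unused (visible C x)) C) l"

lemma length_marks [simp]: "length (marks C l) = length l"
  by (induction l arbitrary: C) auto

lemma visible_insert: "visible (insert (s, r) C) x = (if near x s then insert r (visible C x) else visible C x)"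
  by (auto simp: visible_def)

lemma visible_Un: "visible (C \<union> C') x = visible C x \<union> visible C' x"
  by (auto simp: visible_def)

lemma visible_level: "visible ({s} \<times> U) x = (if near x s then U else {})"
  by (auto simp: visible_def)

lemma marks_cong: "(\<And>x. x \<in> set l \<Longrightarrow> visible C x = visible C' x) \<Longrightarrow> marks C l = marks C' l"
proof (induction l arbitrary: C C')
  case (Cons y l)
  then have "marks (insert p C) l = marks (insert p C') l" for p
    by (cases p) (intro Cons.IH, auto simp: visible_insert)
  then show ?case using Cons.prems by simp
qed simp

lemma visible_shift2: "visible ((\<lambda>(s, r). (s + 2, r)) ` C) (shift2 x) = visible C x"
  by (cases x) (force simp: visible_def)+

lemma marks_map_shift2: "marks ((\<lambda>(s, r). (s + 2, r)) ` C) (map shift2 l) = marks C l"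
proof (induction l arbitrary: C)
  case (Cons x l)
  show ?case using Cons.IH[of "insert (psize x, least_unused (visible C x)) C"]
    by (simp only: list.map marks.simps visible_shift2 image_insert prod.case shift2_simps)
qed simp

text \<open>Genuine parts have positive size, so size 0 is free to stand for the last part size of
  the previous level.\<close>

definition conts :: "bool \<Rightarrow> nat set \<Rightarrow> nat multiset \<Rightarrow> part list set" where
  "conts b A N = {l. gg_list b l \<and> mset (marks ({0} \<times> A) l) = N}"

text \<open>The situation once size 1 is settled: \<open>U\<close> collects what is blocked at size
  2, and \<open>B\<close> is what the next level will see.\<close>

definition level_conts :: "bool \<Rightarrow> nat set \<Rightarrow> nat set \<Rightarrow> nat multiset \<Rightarrow> part list set" where
  "level_conts b U B N = {l. gg_list b l \<and> Over 1 \<notin> set l \<and> mset (marks ({0} \<times> U \<union> {2} \<times> B) l) = N}"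

lemma conts_overpartition: "conts b A N \<subseteq> Collect overpartition" "level_conts b U B N \<subseteq> Collect overpartition"
  by (auto simp: conts_def level_conts_def gg_list_def)

lemma mset_Cons_eq: "mset (c # xs) = N \<longleftrightarrow> c \<in># N \<and> mset xs = N - {#c#}"
  by auto

text \<open>The mark may be moved from size 1 to size 0: a plain 2 sees both sizes, and larger parts
  of a \<open>gg_list\<close> see neither.\<close>

lemma marks_Over1_Cons:
  assumes "gg_list b l" "Over 1 \<notin> set l"
  shows "marks ({0} \<times> A) (Over 1 # l) =
    least_unused A # marks ({0} \<times> insert (least_unused A) A \<union> {2} \<times> {}) l"
proof -
  let ?c = "least_unused A"
  have "marks (insert (1, ?c) ({0} \<times> A)) l = marks ({0} \<times> insert ?c A \<union> {2} \<times> {}) l"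
  proof (rule marks_cong)
    fix x assume "x \<in> set l"
    with gg_list_cases[OF assms(1) this] assms show "visible (insert (1, ?c) ({0} \<times> A)) x = visible ({0} \<times> insert ?c A \<union> {2} \<times> {}) x"
      by (cases x) (auto simp: visible_insert visible_Un visible_level gg_list_def)
  qed
  then show ?thesis by (simp add: visible_level)
qed

text \<open>Entering the mark at size 0 as well is harmless: further parts 2 see it anyway, and
  larger parts do not see size 0.\<close>

lemma marks_Plain2_Cons:
  assumes "gg_list b l" "Over 1 \<notin> set l" "B \<subseteq> U"
  shows "marks ({0} \<times> U \<union> {2} \<times> B) (Plain 2 # l) = least_unused U #
    marks ({0} \<times> insert (least_unused U) U \<union> {2} \<times> insert (least_unused U) B) l"
proof -
  let ?c = "least_unused U"
  have "marks (insert (2, ?c) ({0} \<times> U \<union> {2} \<times> B)) l = marks ({0} \<times> insert ?c U \<union> {2} \<times> insert ?c B) l"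
  proof (rule marks_cong)
    fix x assume "x \<in> set l"
    with gg_list_cases[OF assms(1) this] assms show "visible (insert (2, ?c) ({0} \<times> U \<union> {2} \<times> B)) x = visible ({0} \<times> insert ?c U \<union> {2} \<times> insert ?c B) x"
      by (cases x) (auto simp: visible_insert visible_Un visible_level gg_list_def)
  qed
  moreover have "U \<union> B = U" using assms by auto
  ultimately show ?thesis by (simp add: visible_Un visible_level)
qed

text \<open>The shifted parts have size at least 3 and no longer see size 0; lowering everything by
  two turns size 2 into the new size 0.\<close>

lemma marks_level_shift:
  assumes "gg_list b l"
  shows "marks ({0} \<times> U \<union> {2} \<times> B) (map shift2 l) = marks ({0} \<times> B) l"
proof -
  have "marks ({0} \<times> U \<union> {2} \<times> B) (map shift2 l) = marks ({2} \<times> B) (map shift2 l)"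
  proof (rule marks_cong)
    fix x assume "x \<in> set (map shift2 l)"
    then obtain y where "x = shift2 y" "1 \<le> psize y" using gg_list_size[OF assms] by auto
    then show "visible ({0} \<times> U \<union> {2} \<times> B) x = visible ({2} \<times> B) x"
      by (cases y) (auto simp: visible_Un visible_level)
  qed
  also have "\<dots> = marks ((\<lambda>(s, r). (s + 2, r)) ` ({0} \<times> B)) (map shift2 l)"
    by (rule arg_cong[where f = "\<lambda>C. marks C (map shift2 l)"]) force
  finally show ?thesis unfolding marks_map_shift2 .
qed

lemma level_conts_rec:
  assumes "B \<subseteq> U"
  shows "level_conts b U B N = map shift2 ` conts b B N \<union>
    (if least_unused U \<in># N then (#) (Plain 2) ` level_conts b (insert (least_unused U) U)
       (insert (least_unused U) B) (N - {#least_unused U#}) else {})" (is "?L = ?R")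
proof (rule set_eqI)
  fix l
  let ?c = "least_unused U"
  consider (nogood) "\<not> gg_list b l \<or> Over 1 \<in> set l"
    | (two) l' where "l = Plain 2 # l'" "gg_list b l'" "Over 1 \<notin> set l'"
    | (shift) l' where "l = map shift2 l'" "gg_list b l'" "Over 1 \<notin> set l" "Plain 2 \<notin> set l" "gg_list b l"
    by (metis gg_list_Cons_Plain2 gg_list_Plain2_first gg_list_eq_map_shift2)
  then show "l \<in> ?L \<longleftrightarrow> l \<in> ?R"
  proof cases
    case nogood
    have "gg_list b l \<and> Over 1 \<notin> set l" if "l \<in> ?R"
    proof -
      have "\<exists>l'. gg_list b l' \<and> (l = map shift2 l' \<or> l = Plain 2 # l' \<and> Over 1 \<notin> set l')"
        using that by (auto simp: conts_def level_conts_def split: if_splits)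
      then obtain l' where l': "gg_list b l'" "l = map shift2 l' \<or> l = Plain 2 # l' \<and> Over 1 \<notin> set l'" by blast
      from l'(2) show ?thesis
      proof
        assume l: "l = map shift2 l'"
        have "psize x \<ge> 3" if "x \<in> set l" for x using that l gg_list_size[OF l'(1)] by force
        then have "Over 1 \<notin> set l" by force
        then show ?thesis using l l'(1) gg_list_map_shift2[of l' b] gg_list_size[OF l'(1)] by blast
      qed (use l'(1) in \<open>auto simp: gg_list_Cons_Plain2\<close>)
    qed
    then show ?thesis using nogood by (auto simp: level_conts_def)
  next
    case two
    have "l \<notin> map shift2 ` conts b B N"
    proof
      assume "l \<in> map shift2 ` conts b B N"
      then obtain z l'' where z: "gg_list b (z # l'')" "Plain 2 = shift2 z" using two by (auto simp: conts_def)
      then show False using gg_list_size[OF z(1), of z] by (cases z) auto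
    qed
    moreover have "gg_list b l" "Over 1 \<notin> set l" using two by (auto simp: gg_list_Cons_Plain2)
    ultimately show ?thesis using two marks_Plain2_Cons[OF two(2,3) assms]
      by (auto simp: level_conts_def simp del: marks.simps mset.simps simp: mset_Cons_eq)
  next
    case shift
    have "l \<notin> (#) (Plain 2) ` S" for S using shift by auto
    moreover have "l \<in> map shift2 ` conts b B N \<longleftrightarrow> l' \<in> conts b B N"
      using shift inj_map_shift2[of UNIV] by (auto simp: inj_on_def)
    ultimately show ?thesis using shift marks_level_shift[OF shift(2), of U B]
      by (auto simp: level_conts_def conts_def)
  qed
qed

lemma conts_rec:
  "conts b A N = level_conts b A {} N \<union>
    (if b \<and> least_unused A \<in># N then (#) (Over 1) ` level_conts b (insert (least_unused A) A) {}
       (N - {#least_unused A#}) else {})" (is "?L = ?R")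
proof (rule set_eqI)
  fix l
  consider (no) "Over 1 \<notin> set l" | (nogood) "\<not> gg_list b l" "Over 1 \<in> set l"
    | (one) l' where "l = Over 1 # l'" "gg_list b l'" "Over 1 \<notin> set l'" b
    by (metis gg_list_Cons_Over1 gg_list_Over1_first)
  then show "l \<in> ?L \<longleftrightarrow> l \<in> ?R"
  proof cases
    case one
    then show ?thesis using marks_Over1_Cons[OF one(2,3)] 
      by (auto simp: level_conts_def conts_def gg_list_Cons_Over1 simp del: marks.simps mset.simps simp: mset_Cons_eq)
  qed (auto simp: level_conts_def conts_def gg_list_Cons_Over1)
qed

lemma conts_empty: "conts b A {#} = {[]}"
  by (auto simp: conts_def) (metis length_0_conv length_marks)

text \<open>All terms share one power of \<open>fps_X\<close>: a plain 2 weighs two, and every part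
  left over is raised by two when the level is left.\<close>

lemma weight_gf_level_conts:
  assumes "B \<subseteq> U"
  shows "weight_gf (level_conts b U B N) = fps_X ^ (2 * size N) * level_sum (\<lambda>A N. weight_gf (conts b A N)) U B N"
  using assms
proof (induction "size N" arbitrary: N U B rule: less_induct)
  case less
  let ?c = "least_unused U"
  have len: "length l = size N" if "l \<in> conts b B N" for l
    using that by (auto simp: conts_def)
  have 1: "weight_gf (map shift2 ` conts b B N) = fps_X ^ (2 * size N) * weight_gf (conts b B N)"
    by (rule weight_gf_image) (auto simp: inj_map_shift2 weight_map_shift2 len)
  show ?case
  proof (cases "?c \<in># N")
    case False
    then show ?thesis using less.prems by (simp add: level_conts_rec level_sum.simps[of _ U] 1)
  next
    case True
    let ?L = "level_conts b (insert ?c U) (insert ?c B) (N - {#?c#})"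
    have sz: "2 * size N = 2 + 2 * size (N - {#?c#})" using size_Suc_Diff1[OF True] by simp
    have "weight_gf ((#) (Plain 2) ` ?L) = fps_X ^ 2 * weight_gf ?L"
      by (rule weight_gf_image) (auto simp: weight_def)
    also have "\<dots> = fps_X ^ (2 * size N) * level_sum (\<lambda>A N. weight_gf (conts b A N)) (insert ?c U) (insert ?c B) (N - {#?c#})"
      using less.hyps[of "N - {#?c#}" "insert ?c B" "insert ?c U"] less.prems size_Diff1_less[OF True]
      unfolding sz power_add by (simp add: mult.assoc subset_insertI2)
    finally have 2: "weight_gf ((#) (Plain 2) ` ?L) = \<dots>" .
    have "weight_gf (level_conts b U B N) = weight_gf (map shift2 ` conts b B N) + weight_gf ((#) (Plain 2) ` ?L)"
      unfolding level_conts_rec[OF less.prems, of b N] if_P[OF True]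
    proof (rule weight_gf_Un)
      have "map shift2 l \<noteq> Plain 2 # l'" if l: "l \<in> conts b B N" for l l'
      proof
        assume "map shift2 l = Plain 2 # l'"
        then obtain z l'' where z: "gg_list b (z # l'')" "shift2 z = Plain 2" using l by (auto simp: conts_def)
        then show False using gg_list_size[OF z(1), of z] by (cases z) auto
      qed
      then show "map shift2 ` conts b B N \<inter> (#) (Plain 2) ` ?L = {}" unfolding disjoint_iff image_iff by metis
      show "map shift2 ` conts b B N \<subseteq> Collect overpartition" "(#) (Plain 2) ` ?L \<subseteq> Collect overpartition"
        using conts_overpartition(2)[of b U B N, unfolded level_conts_rec[OF less.prems, of b N] if_P[OF True] Un_subset_iff]
        by blast+
    qed
    then show ?thesis unfolding 1 2 level_sum.simps[of _ U B N] using True by (simp add: distrib_left)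
  qed
qed

lemma weight_gf_conts:
  "weight_gf (conts b A N) = fps_X ^ (2 * size N) * level_sum (\<lambda>A N. weight_gf (conts b A N)) A {} N
      + (if b \<and> least_unused A \<in># N
         then fps_X ^ (2 * size N - 1) * level_sum (\<lambda>A N. weight_gf (conts b A N)) (insert (least_unused A) A) {} (N - {#least_unused A#})
         else 0)"
proof (cases "b \<and> least_unused A \<in># N")
  case False
  then show ?thesis by (simp only: conts_rec[of b A N]) (simp add: weight_gf_level_conts)
next
  case True
  let ?c = "least_unused A"
  let ?L = "level_conts b (insert ?c A) {} (N - {#?c#})"
  \<comment> \<open>The overlined 1 weighs one where a plain 2 would weigh two.\<close>
  have sz: "2 * size N - 1 = 1 + 2 * size (N - {#?c#})" using size_Suc_Diff1[of ?c N] True by simp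
  have "weight_gf ((#) (Over 1) ` ?L) = fps_X ^ 1 * weight_gf ?L"
    by (rule weight_gf_image) (auto simp: weight_def)
  then have "weight_gf ((#) (Over 1) ` ?L) = fps_X ^ (2 * size N - 1) * level_sum (\<lambda>A N. weight_gf (conts b A N)) (insert ?c A) {} (N - {#?c#})"
    unfolding sz power_add by (simp add: weight_gf_level_conts mult.assoc)
  moreover have "weight_gf (conts b A N) = weight_gf (level_conts b A {} N) + weight_gf ((#) (Over 1) ` ?L)"
    unfolding conts_rec[of b A N] if_P[OF True]
  proof (rule weight_gf_Un)
    show "level_conts b A {} N \<inter> (#) (Over 1) ` ?L = {}" by (auto simp: level_conts_def)
    show "level_conts b A {} N \<subseteq> Collect overpartition" "(#) (Over 1) ` ?L \<subseteq> Collect overpartition"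
      using conts_overpartition(1)[of b A N, unfolded conts_rec[of b A N] if_P[OF True] Un_subset_iff] by blast+
  qed
  ultimately show ?thesis using True by (simp add: weight_gf_level_conts)
qed

lemma weight_gf_conts_empty: "weight_gf (conts b A {#}) = 1"
proof (rule fps_ext)
  fix n
  have "{l \<in> conts b A {#}. weight l = n} = (if n = 0 then {[]} else {})" by (auto simp: conts_empty weight_def)
  then show "fps_nth (weight_gf (conts b A {#})) n = fps_nth 1 n" by (simp add: weight_gf_def)
qed

interpretation gg: full_gf "\<lambda>A N. weight_gf (conts False A N)" "\<lambda>A N. weight_gf (conts True A N)"
proof
  fix A :: "nat set" and N
  show "weight_gf (conts False A N) = fps_X ^ (2 * size N) * level_sum (\<lambda>A N. weight_gf (conts False A N)) A {} N"
    using weight_gf_conts[of False A N] by simp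
  show "weight_gf (conts True A N) = fps_X ^ (2 * size N) * level_sum (\<lambda>A N. weight_gf (conts True A N)) A {} N
      + (if least_unused A \<in># N
         then fps_X ^ (2 * size N - 1) * level_sum (\<lambda>A N. weight_gf (conts True A N)) (insert (least_unused A) A) {} (N - {#least_unused A#})
         else 0)"
    using weight_gf_conts[of True A N] by simp
qed (simp_all add: weight_gf_conts_empty)

subsection \<open>Comparison with the marking of the definition\<close>

lemma nth_marks:
  assumes "p < length l"
  shows "marks C l ! p =
    least_unused (visible (C \<union> (\<lambda>j. (psize (l ! j), marks C l ! j)) ` {..<p}) (l ! p))"
  using assms
proof (induction l arbitrary: C p)
  case (Cons x l)
  show ?case
  proof (cases p)
    case (Suc q)
    let ?m = "least_unused (visible C x)"
    let ?D = "insert (psize x, ?m) C"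
    have "C \<union> (\<lambda>j. (psize ((x # l) ! j), marks C (x # l) ! j)) ` {..<p} =
      ?D \<union> (\<lambda>j. (psize (l ! j), marks ?D l ! j)) ` {..<q}"
      unfolding Suc lessThan_Suc_eq_insert_0 by (auto simp: image_image)
    then show ?thesis using Cons.IH[of q ?D] Cons.prems Suc by simp
  qed simp
qed simp

lemma gg_mark_eq_marks:
  assumes "gg_list b l" "p < length l"
  shows "gg_mark l p = marks {} l ! p"
  using assms(2)
proof (induction p rule: less_induct)
  case (less p)
  let ?C = "(\<lambda>j. (psize (l ! j), gg_mark l j)) ` {..<p}"
  have "(\<lambda>j. (psize (l ! j), marks {} l ! j)) ` {..<p} = ?C"
    using less by (intro image_cong) auto
  then have m: "marks {} l ! p = least_unused (visible ?C (l ! p))"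
    using nth_marks[OF less.prems, of "{}"] by simp
  have x: "l ! p \<in> set l" using less.prems by simp
  show ?case
  proof (cases "p = 0")
    case True
    then show ?thesis using m by (subst gg_mark.simps) (simp add: visible_def least_unused_1)
  next
    case False
    show ?thesis
    proof (cases "l ! p")
      case (Over s)
      then have "odd s" using x assms(1) by (force simp: gg_list_def)
      moreover have "visible ?C (l ! p) = gg_mark l ` {j \<in> {..<p}. s = psize (l ! j) + 1}"
        using Over by (auto simp: visible_def)
      ultimately show ?thesis unfolding m using False Over by (subst gg_mark.simps) simp
    next
      case (Plain s)
      then have s: "even s" "1 \<le> s" using x assms(1) gg_list_size[OF assms(1) x] by (force simp: gg_list_def)+
      \<comment> \<open>So condition (iii) of clause (d) fails and the mark is
        \<open>f\<close>.\<close>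
      then have "Plain (s - 1) \<notin> set l" "Over s \<notin> set l" using assms(1) by (force simp: gg_list_def)+
      moreover have "visible ?C (l ! p) = gg_mark l ` {j \<in> {..<p}. s \<le> psize (l ! j) + 2}"
        using Plain by (auto simp: visible_def)
      ultimately show ?thesis unfolding m using False Plain s by (subst gg_mark.simps) (simp add: Let_def)
    qed
  qed
qed

lemma count_list_eq_card: "count_list l x = card {p. p < length l \<and> l ! p = x}"
  unfolding count_list_eq_length_filter length_filter_conv_card by (simp add: eq_commute)

lemma card_gg_mark:
  assumes "gg_list b l"
  shows "card {p. p < length l \<and> gg_mark l p = r} = count (mset (marks {} l)) r"
proof -
  have "{p. p < length l \<and> gg_mark l p = r} = {p. p < length (marks {} l) \<and> marks {} l ! p = r}"
    using gg_mark_eq_marks[OF assms] by auto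
  then show ?thesis by (simp add: count_mset count_list_eq_card)
qed

lemma marks_distinct_near:
  assumes "j < p" "p < length l" "near (l ! p) (psize (l ! j))"
  shows "marks {} l ! p \<noteq> marks {} l ! j"
proof -
  let ?C = "(\<lambda>j. (psize (l ! j), marks {} l ! j)) ` {..<p}"
  have "visible ?C (l ! p) \<subseteq> snd ` ?C" by (force simp: visible_def)
  then have "finite (visible ?C (l ! p))" by (rule finite_subset) auto
  moreover have "marks {} l ! j \<in> visible ?C (l ! p)" using assms by (auto simp: visible_def)
  ultimately show ?thesis using nth_marks[OF assms(2), of "{}"] least_unused_props(2) by force
qed

text \<open>Of any two of these parts the later sees the earlier, so their marks are distinct
  elements of \<open>{1..<k}\<close>. This yields condition (2) of \<open>O_set\<close>.\<close>

lemma gg_list_count_le: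
  assumes "gg_list b l" "set (marks {} l) \<subseteq> {1..<k}"
  shows "count_list l (Plain (2 * t)) + count_list l (Over (2 * t + 1)) + count_list l (Plain (2 * t + 2)) \<le> k - 1"
proof -
  let ?S = "\<lambda>x. {p. p < length l \<and> l ! p = x}"
  let ?X = "?S (Plain (2 * t)) \<union> ?S (Over (2 * t + 1)) \<union> ?S (Plain (2 * t + 2))"
  have le: "part_le (l ! j) (l ! p)" if "j < p" "p < length l" for j p
    using assms(1) that sorted_wrt_nth_less by (auto simp: gg_list_def overpartition_def)
  \<comment> \<open>Two equal overlined parts would not see each other, so their absence is needed
    for distinct marks.\<close>
  have "card (?S (Over (2 * t + 1))) \<le> 1"
    using assms(1) unfolding count_list_eq_card[symmetric] by (simp add: gg_list_def overpartition_def)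
  then have once: "j = p" if "j \<in> ?S (Over (2 * t + 1))" "p \<in> ?S (Over (2 * t + 1))" for j p
    using that card_le_Suc0_iff_eq[of "?S (Over (2 * t + 1))"] by (auto simp: One_nat_def)
  have neq: "marks {} l ! p \<noteq> marks {} l ! j" if "j < p" "j \<in> ?X" "p \<in> ?X" for j p
  proof (rule marks_distinct_near)
    show "j < p" "p < length l" using that by auto
    then show "near (l ! p) (psize (l ! j))"
      using that le[of j p] once[of j p] by (auto simp: part_le_def)
  qed
  have inj: "inj_on ((!) (marks {} l)) ?X"
  proof (rule inj_onI, rule ccontr)
    fix j p assume jp: "j \<in> ?X" "p \<in> ?X" "marks {} l ! j = marks {} l ! p" "j \<noteq> p"
    then show False using neq[OF _ jp(1,2)] neq[OF _ jp(2,1)] by (cases j p rule: linorder_cases) auto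
  qed
  have "(!) (marks {} l) ` ?X \<subseteq> set (marks {} l)" by (auto intro!: nth_mem)
  then have "(!) (marks {} l) ` ?X \<subseteq> {1..<k}" using assms(2) by blast
  then have "card ?X \<le> k - 1" using card_inj_on_le[OF inj, of "{1..<k}"] by simp
  moreover have "card ?X = card (?S (Plain (2 * t))) + card (?S (Over (2 * t + 1))) + card (?S (Plain (2 * t + 2)))"
    (is "card (?S1 \<union> ?S2 \<union> ?S3) = _")
  proof -
    have "card (?S1 \<union> ?S2 \<union> ?S3) = card (?S1 \<union> ?S2) + card ?S3" by (rule card_Un_disjoint) auto
    also have "card (?S1 \<union> ?S2) = card ?S1 + card ?S2" by (rule card_Un_disjoint) auto
    finally show ?thesis .
  qed
  ultimately show ?thesis by (simp add: count_list_eq_card)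
qed

text \<open>
  Putting the marks \<open>i, \<dots>, k - 1\<close> at size \<open>0\<close> encodes the bound on \<open>f\<^bsub>1\<^esub> + f\<^bsub>2\<^esub>\<close> (overlined 1 and
  plain 2): as long as it is at most \<open>i - 1\<close> these marks are never in the way, and otherwise a mark
  \<open>k\<close> or larger appears.
\<close>

lemma marks_first_level:
  assumes "gg_list b l" "Over 1 \<notin> set l" "g < i" "i \<le> k" "B \<subseteq> {1..g}"
  shows "if g + count_list l (Plain 2) < i
    then marks ({0} \<times> {1..g} \<union> {2} \<times> B) l = marks ({0} \<times> ({1..g} \<union> {i..<k}) \<union> {2} \<times> B) l
    else \<exists>r \<in> set (marks ({0} \<times> ({1..g} \<union> {i..<k}) \<union> {2} \<times> B) l). k \<le> r"
  using assms
proof (induction l arbitrary: g B)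
  case (Cons x l)
  \<comment> \<open>Here \<open>g\<close> stands for the number of parts of the first level marked
    so far; their marks fill \<open>{1..g}\<close>.\<close>
  have lg: "least_unused {1..g} = g + 1" by (rule least_unused_eqI) auto
  show ?case
  proof (cases "x = Plain 2")
    case True
    then have l: "gg_list b l" "Over 1 \<notin> set l" using Cons.prems by (auto simp: gg_list_Cons_Plain2)
    note step = marks_Plain2_Cons[OF l]
    show ?thesis
    proof (cases "g + 1 < i")
      case g: True
      have lg': "least_unused ({1..g} \<union> {i..<k}) = g + 1" by (rule least_unused_eqI) (use g in auto)
      have ins: "insert (g + 1) {1..g} = {1..g + 1}" "insert (g + 1) ({1..g} \<union> {i..<k}) = {1..g + 1} \<union> {i..<k}" by auto
      have B: "insert (g + 1) B \<subseteq> {1..g + 1}" "B \<subseteq> {1..g}" "B \<subseteq> {1..g} \<union> {i..<k}" using Cons.prems by auto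
      have cnt: "g + count_list (x # l) (Plain 2) = (g + 1) + count_list l (Plain 2)" using True by simp
      have 1: "marks ({0} \<times> {1..g} \<union> {2} \<times> B) (x # l) = (g + 1) # marks ({0} \<times> {1..g + 1} \<union> {2} \<times> insert (g + 1) B) l"
        using step[OF B(2)] unfolding True lg ins .
      have 2: "marks ({0} \<times> ({1..g} \<union> {i..<k}) \<union> {2} \<times> B) (x # l)
        = (g + 1) # marks ({0} \<times> ({1..g + 1} \<union> {i..<k}) \<union> {2} \<times> insert (g + 1) B) l"
        using step[OF B(3)] unfolding True lg' ins .
      show ?thesis using Cons.IH[OF l g Cons.prems(4) B(1)] unfolding 1 2 cnt
        by (simp split: if_splits)
    next
      case False
      then have g: "i = g + 1" using Cons.prems by simp
      \<comment> \<open>Now \<open>{1..g}\<close> and \<open>{i..<k}\<close> together exhaust the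
        marks below \<open>k\<close>.\<close>
      have "least_unused ({1..g} \<union> {i..<k}) = k" by (rule least_unused_eqI) (use g Cons.prems in auto)
      moreover have "B \<subseteq> {1..g} \<union> {i..<k}" using Cons.prems by auto
      ultimately have "k \<in> set (marks ({0} \<times> ({1..g} \<union> {i..<k}) \<union> {2} \<times> B) (x # l))"
        using step[of B "{1..g} \<union> {i..<k}"] True by simp
      moreover have "\<not> g + count_list (x # l) (Plain 2) < i" using True g by simp
      ultimately show ?thesis by auto
    qed
  next
    case False
    then have no: "Plain 2 \<notin> set (x # l)" using gg_list_Plain2_first[OF Cons.prems(1,2)] by auto
    have "marks ({0} \<times> {1..g} \<union> {2} \<times> B) (x # l) = marks ({0} \<times> ({1..g} \<union> {i..<k}) \<union> {2} \<times> B) (x # l)"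
    proof (rule marks_cong)
      fix y assume y: "y \<in> set (x # l)"
      then have "3 \<le> psize y" using gg_list_cases[OF Cons.prems(1) y] no Cons.prems(2) by auto
      then show "visible ({0} \<times> {1..g} \<union> {2} \<times> B) y = visible ({0} \<times> ({1..g} \<union> {i..<k}) \<union> {2} \<times> B) y"
        by (cases y rule: part.exhaust) (simp_all add: visible_Un visible_level)
    qed
    moreover have "count_list (x # l) (Plain 2) = 0" using no by (auto simp: count_list_0_iff)
    ultimately show ?thesis using Cons.prems(3) by (simp del: marks.simps count_list.simps)
  qed
qed auto

text \<open>An overlined 1 counts like a plain 2: in the context \<open>{i..<k}\<close> it takes
  mark 1 if \<open>i > 1\<close>, while for \<open>i = 1\<close> all marks below \<open>k\<close>
  are blocked and it takes \<open>k\<close>.\<close>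

lemma marks_initial:
  assumes "gg_list b l" "1 \<le> i" "i \<le> k"
  shows "if count_list l (Over 1) + count_list l (Plain 2) < i
    then marks {} l = marks ({0} \<times> {i..<k}) l
    else \<exists>r \<in> set (marks ({0} \<times> {i..<k}) l). k \<le> r"
proof (cases "Over 1 \<in> set l")
  case False
  then show ?thesis using marks_first_level[OF assms(1) False, of 0 i k "{}"] assms
    by (auto simp: count_list_0_iff split: if_splits)
next
  case True
  then obtain l' where l': "l = Over 1 # l'" using gg_list_Over1_first assms by blast
  then have g: "gg_list b l'" "Over 1 \<notin> set l'" using assms by (auto simp: gg_list_Cons_Over1)
  have cnt: "count_list l (Over 1) + count_list l (Plain 2) = 1 + count_list l' (Plain 2)"
    using g(2) unfolding l' by (simp add: count_list_0_iff)
  note m = marks_Over1_Cons[OF g, folded l']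
  show ?thesis
  proof (cases "i = 1")
    case True
    have "least_unused {i..<k} = k" by (rule least_unused_eqI) (use True assms in auto)
    then show ?thesis using m[of "{i..<k}"] cnt True by simp
  next
    case False
    have lu: "least_unused {i..<k} = 1" "least_unused {} = 1" using assms False by (auto intro!: least_unused_1)
    have ins: "insert 1 {i..<k} = {1..1} \<union> {i..<k}" "insert 1 {} = {1..(1::nat)}" by auto
    have 1: "marks {} l = 1 # marks ({0} \<times> {1..1} \<union> {2} \<times> {}) l'" using m[of "{}"] unfolding lu ins by simp
    have 2: "marks ({0} \<times> {i..<k}) l = 1 # marks ({0} \<times> ({1..1} \<union> {i..<k}) \<union> {2} \<times> {}) l'" using m[of "{i..<k}"] unfolding lu ins .
    have "1 < i" using False assms by simp
    from marks_first_level[OF g this assms(3), of "{}"] show ?thesis unfolding 1 2 cnt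
      by (simp split: if_splits)
  qed
qed

section \<open>The marked sets as sets of continuations\<close>

definition mark_mset :: "nat \<Rightarrow> (nat \<Rightarrow> nat) \<Rightarrow> nat multiset" where
  "mark_mset k N = (\<Sum>r = 1..k - 1. replicate_mset (N r) r)"

lemma count_mark_mset: "count (mark_mset k N) r = (if r \<in> {1..k - 1} then N r else 0)"
  by (auto simp: mark_mset_def count_sum sum.delta)

lemma size_mark_mset: "size (mark_mset k N) = (\<Sum>r = 1..k - 1. N r)"
  by (simp add: mark_mset_def size_multiset_sum)

lemma set_mark_mset: "set_mset (mark_mset k N) \<subseteq> {1..<k}"
proof
  fix r assume "r \<in># mark_mset k N"
  then have "count (mark_mset k N) r > 0" by simp
  then show "r \<in> {1..<k}" by (auto simp: count_mark_mset split: if_splits)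
qed

text \<open>With the size prescribed there is no room for marks outside \<open>{1..k - 1}\<close>;
  in this way the number of parts in \<open>F_marked\<close> excludes marks from \<open>k\<close>
  on.\<close>

lemma eq_mark_mset_iff:
  "M = mark_mset k N \<longleftrightarrow> size M = (\<Sum>r = 1..k - 1. N r) \<and> (\<forall>r\<in>{1..k - 1}. count M r = N r)"
proof
  assume "size M = (\<Sum>r = 1..k - 1. N r) \<and> (\<forall>r\<in>{1..k - 1}. count M r = N r)"
  then have "mark_mset k N \<subseteq># M" "size M = size (mark_mset k N)"
    by (auto simp: subseteq_mset_def count_mark_mset size_mark_mset)
  then show "M = mark_mset k N" by (metis mset_subset_size subset_mset.le_imp_less_or_eq less_irrefl)
qed (auto simp: size_mark_mset count_mark_mset)

text \<open>For such lists condition (2) follows from the marks being below \<open>k\<close>, and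
  (3) is vacuous without plain odd parts. The remaining bound by \<open>i - 1\<close> is traded for
  the context \<open>{i..<k}\<close> by \<open>marks_initial\<close>.\<close>

lemma G_marked_eq_conts:
  assumes "1 \<le> i" "i \<le> k"
  shows "G_marked k i N = conts True {i..<k} (mark_mset k N)"
proof (rule set_eqI)
  fix l
  let ?c = "count_list l (Over 1) + count_list l (Plain 2)"
  have "l \<in> G_marked k i N \<longleftrightarrow> gg_list True l \<and> mset (marks {} l) = mark_mset k N \<and> ?c < i"
  proof
    assume l: "l \<in> G_marked k i N"
    then have g: "gg_list True l" by (auto simp: G_marked_def F_marked_def F_set_def O_set_def gg_list_def)
    moreover have "mset (marks {} l) = mark_mset k N"
      unfolding eq_mark_mset_iff using l card_gg_mark[OF g]
      by (auto simp: G_marked_def F_marked_def F_set_def O_set_def)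
    moreover have "?c < i"
      using l by (auto simp: G_marked_def F_marked_def F_set_def O_set_def f_over_def f_plain_def)
    ultimately show "gg_list True l \<and> mset (marks {} l) = mark_mset k N \<and> ?c < i" by simp
  next
    assume l: "gg_list True l \<and> mset (marks {} l) = mark_mset k N \<and> ?c < i"
    then have g: "gg_list True l" and m: "mset (marks {} l) = mark_mset k N" and c: "?c < i" by auto
    have types: "(overlined x \<longrightarrow> odd (psize x)) \<and> (\<not> overlined x \<longrightarrow> even (psize x))" if "x \<in> set l" for x
      using g that by (auto simp: gg_list_def split: if_splits)
    have "set (marks {} l) \<subseteq> {1..<k}" using m set_mark_mset[of k N] by (metis set_mset_mset)
    note le = gg_list_count_le[OF g this]
    have no: "Over (2 * t) \<notin> set l" "Plain (2 * t + 1) \<notin> set l" for t using types by fastforce+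
    have "f_over l (2 * t) + f_plain l (2 * t) + f_over l (2 * t + 1) + f_plain l (2 * t + 2) \<le> k - 1" for t
      using le[of t] no[of t] by (cases "t = 0") (simp_all add: f_over_def f_plain_def count_list_0_iff)
    then have "int (f_over l (2 * t) + f_plain l (2 * t) + f_over l (2 * t + 1) + f_plain l (2 * t + 2)) \<le> int k - 1" for t
      using assms by (smt (verit) of_nat_diff of_nat_1 of_nat_mono order_trans)
    moreover have "f_plain l (2 * t + 1) = 0" for t using no[of t] by (simp add: f_plain_def count_list_0_iff)
    moreover have "int (f_over l 1 + f_plain l 2) \<le> int i - 1" using c by (simp add: f_over_def f_plain_def)
    moreover have "size (mset (marks {} l)) = length l" by simp
    ultimately have "l \<in> O_set k i (\<Sum>r = 1..k - 1. N r) (weight l)"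
      using g m by (simp add: O_set_def gg_list_def eq_mark_mset_iff)
    then have "l \<in> F_set k i (\<Sum>r = 1..k - 1. N r) (weight l)"
      using types[of "hd l"] by (auto simp: F_set_def)
    then show "l \<in> G_marked k i N"
      using types m card_gg_mark[OF g] unfolding G_marked_def F_marked_def eq_mark_mset_iff by auto
  qed
  also have "\<dots> \<longleftrightarrow> l \<in> conts True {i..<k} (mark_mset k N)"
  proof (cases "gg_list True l")
    case True
    show ?thesis
    proof (cases "?c < i")
      case False
      then obtain r where r: "r \<in> set (marks ({0} \<times> {i..<k}) l)" "k \<le> r"
        using marks_initial[OF True assms] by auto
      have "mset (marks ({0} \<times> {i..<k}) l) \<noteq> mark_mset k N"
      proof
        assume "mset (marks ({0} \<times> {i..<k}) l) = mark_mset k N"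
        then have "r \<in># mark_mset k N" using r(1) by (metis set_mset_mset)
        then show False using set_mark_mset[of k N] r(2) by auto
      qed
      then show ?thesis using False by (simp add: conts_def)
    qed (use True marks_initial[OF True assms] in \<open>simp add: conts_def\<close>)
  qed (simp add: conts_def)
  finally show "l \<in> G_marked k i N \<longleftrightarrow> l \<in> conts True {i..<k} (mark_mset k N)" .
qed

lemma E_marked_eq_conts:
  assumes "1 \<le> i" "i \<le> k"
  shows "E_marked k i N = conts False {i..<k} (mark_mset k N)"
  unfolding E_marked_def G_marked_eq_conts[OF assms] conts_def gg_list_def by (auto split: if_splits)

subsection \<open>The bijection\<close>

text \<open>Bijections between the finite fibres are glued; each is chosen by cardinality alone, so
  the map is not explicit.\<close>

lemma bij_betw_of_equal_fibres:
  fixes f :: "'a \<Rightarrow> nat" and g :: "'b \<Rightarrow> nat"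
  assumes "\<And>n. finite {x \<in> A. f x = n}" "\<And>n. finite {y \<in> B. g y = n}"
    and "\<And>n. card {x \<in> A. f x = n} = card {y \<in> B. g y = n}"
  shows "\<exists>h. bij_betw h A B \<and> (\<forall>x\<in>A. g (h x) = f x)"
proof -
  have "\<forall>n. \<exists>h. bij_betw h {x \<in> A. f x = n} {y \<in> B. g y = n}"
    using assms by (intro allI finite_same_card_bij) auto
  then obtain H where H: "\<And>n. bij_betw (H n) {x \<in> A. f x = n} {y \<in> B. g y = n}" by metis
  define h where "h = (\<lambda>x. H (f x) x)"
  have h: "h x \<in> B \<and> g (h x) = f x" if "x \<in> A" for x
    using bij_betwE[OF H[of "f x"]] that by (auto simp: h_def)
  have "inj_on h A"
  proof (rule inj_onI)
    fix x y assume xy: "x \<in> A" "y \<in> A" "h x = h y"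
    then have "f x = f y" using h by metis
    then show "x = y" using xy bij_betw_imp_inj_on[OF H[of "f y"]] by (auto simp: h_def inj_on_def)
  qed
  moreover have "h ` A = B"
  proof
    show "B \<subseteq> h ` A"
    proof
      fix y assume "y \<in> B"
      then have "y \<in> H (g y) ` {x \<in> A. f x = g y}" using bij_betw_imp_surj_on[OF H[of "g y"]] by auto
      then obtain x where "x \<in> A" "f x = g y" "y = H (f x) x" by auto
      then show "y \<in> h ` A" unfolding h_def by blast
    qed
  qed (use h in auto)
  ultimately show ?thesis using h by (auto simp: bij_betw_def)
qed

section \<open>The generating function of the sets \<open>D_set\<close>\<close>

lemma D_set_0: "D_set 0 = {[]}"
proof -
  have "\<eta> = []" if "\<forall>x\<in>set \<eta>. (1::int) \<le> x \<and> x \<le> - 1" for \<eta> using that by (cases \<eta>) auto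
  then show ?thesis by (auto simp: D_set_def)
qed

lemma D_set_Suc: "D_set (Suc n) = D_set n \<union> (#) (- 1 - 2 * int n) ` D_set n"
proof (rule set_eqI)
  fix \<eta>
  \<comment> \<open>Parity excludes the one integer between \<open>- 1 - 2 * int n\<close> and
    \<open>1 - 2 * int n\<close>.\<close>
  have rest: "(1 - 2 * int (Suc n) \<le> x \<and> x \<noteq> - 1 - 2 * int n) \<longleftrightarrow> 1 - 2 * int n \<le> x" if "odd x" for x
    using that by presburger
  show "\<eta> \<in> D_set (Suc n) \<longleftrightarrow> \<eta> \<in> D_set n \<union> (#) (- 1 - 2 * int n) ` D_set n"
  proof (cases \<eta>)
    case (Cons y \<zeta>)
    show ?thesis
    proof (cases "y = - 1 - 2 * int n")
      case True
      have "(\<forall>x\<in>set \<zeta>. y < x \<and> odd x \<and> 1 - 2 * int (Suc n) \<le> x \<and> x \<le> - 1) \<longleftrightarrow>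
          (\<forall>x\<in>set \<zeta>. odd x \<and> 1 - 2 * int n \<le> x \<and> x \<le> - 1)"
        using rest True by (intro ball_cong refl) force
      then show ?thesis using Cons True by (auto simp: D_set_def ball_conj_distrib)
    next
      case False
      have "\<eta> \<in> D_set (Suc n) \<longleftrightarrow> \<eta> \<in> D_set n"
      proof
        assume e: "\<eta> \<in> D_set (Suc n)"
        have "x \<noteq> - 1 - 2 * int n" if "x \<in> set \<eta>" for x
          using e False that unfolding Cons D_set_def by force
        then show "\<eta> \<in> D_set n" using e rest by (auto simp: D_set_def)
      qed (force simp: D_set_def)
      then show ?thesis using False Cons by auto
    qed
  qed (simp add: D_set_def)
qed

lemma finite_D_set: "finite (D_set n)"
  by (induction n) (simp_all add: D_set_0 D_set_Suc)

text \<open>The least possible sum is \<open>- (1 + 3 + ... + (2n - 1)) = - n^2\<close>; so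
  \<open>nat\<close> loses nothing in \<open>D_set_gf\<close>.\<close>

lemma D_set_sum_ge: "\<eta> \<in> D_set n \<Longrightarrow> 0 \<le> (int n)\<^sup>2 + sum_list \<eta>"
proof (induction n arbitrary: \<eta>)
  case (Suc n)
  then obtain \<zeta> where "\<zeta> \<in> D_set n" "\<eta> = \<zeta> \<or> \<eta> = (- 1 - 2 * int n) # \<zeta>" by (auto simp: D_set_Suc)
  with Suc.IH[of \<zeta>] show ?case by (auto simp: power2_eq_square algebra_simps)
qed (simp add: D_set_0)

text \<open>From \<open>n\<close> to \<open>n + 1\<close> the square grows by \<open>2n + 1\<close>.
  The new element \<open>- 1 - 2n\<close> cancels this growth; without it the factor
  \<open>fps_X ^ (2 * n + 1)\<close> appears.\<close>

lemma D_set_gf: "(\<Sum>\<eta>\<in>D_set n. fps_X ^ nat ((int n)\<^sup>2 + sum_list \<eta>)) = gg.odd_prod n"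
proof (induction n)
  case 0
  then show ?case by (simp add: D_set_0 gg.odd_prod_def)
next
  case (Suc n)
  let ?a = "- 1 - 2 * int n"
  let ?t = "\<lambda>n \<eta>. fps_X ^ nat ((int n)\<^sup>2 + sum_list \<eta>) :: int fps"
  have sq: "(int (Suc n))\<^sup>2 = (int n)\<^sup>2 + (2 * int n + 1)" by (simp add: power2_eq_square algebra_simps)
  have "?a # \<zeta> \<notin> D_set n" for \<zeta> by (simp add: D_set_def)
  then have "D_set n \<inter> (#) ?a ` D_set n = {}" by blast
  then have "sum (?t (Suc n)) (D_set (Suc n)) = sum (?t (Suc n)) (D_set n) + sum (?t (Suc n)) ((#) ?a ` D_set n)"
    unfolding D_set_Suc by (intro sum.union_disjoint) (auto simp: finite_D_set)
  also have "sum (?t (Suc n)) ((#) ?a ` D_set n) = (\<Sum>\<eta>\<in>D_set n. ?t (Suc n) (?a # \<eta>))"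
    by (subst sum.reindex) (auto simp: o_def)
  also have "\<dots> = sum (?t n) (D_set n)"
    unfolding sq by (intro sum.cong refl arg_cong[where f = "\<lambda>e. fps_X ^ nat e"]) simp
  also have "sum (?t (Suc n)) (D_set n) = (\<Sum>\<eta>\<in>D_set n. ?t n \<eta> * fps_X ^ (2 * n + 1))"
  proof (intro sum.cong refl)
    fix \<eta> assume "\<eta> \<in> D_set n"
    then have "nat ((int (Suc n))\<^sup>2 + sum_list \<eta>) = nat ((int n)\<^sup>2 + sum_list \<eta>) + (2 * n + 1)"
      using D_set_sum_ge[of \<eta> n] unfolding sq by linarith
    then show "?t (Suc n) \<eta> = ?t n \<eta> * fps_X ^ (2 * n + 1)" by (simp only: power_add)
  qed
  also have "\<dots> = gg.odd_prod n * fps_X ^ (2 * n + 1)" unfolding sum_distrib_right[symmetric] Suc ..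
  finally show ?case unfolding gg.odd_prod_Suc Suc distrib_left mult_1_right add.commute[of "gg.odd_prod n"] .
qed

theorem theorem5p1:
  fixes k i :: nat and N :: "nat \<Rightarrow> nat"
  assumes "1 \<le> i" and "i \<le> k"
    and "\<forall>r. 1 \<le> r \<and> r + 1 \<le> k - 1 \<longrightarrow> N (r + 1) \<le> N r"
    and "k = 1 \<longrightarrow> N 1 = 0"
  shows "\<exists>\<Theta>. bij_betw \<Theta> (G_marked k i N) (D_set (N 1) \<times> E_marked k i N) \<and>
           (\<forall>\<mu> \<in> G_marked k i N. \<forall>\<eta> \<nu>. \<Theta> \<mu> = (\<eta>, \<nu>) \<longrightarrow>
              int (weight \<mu>) = sum_list \<eta> + int (weight \<nu>))"
proof -
  let ?n = "N 1" and ?A = "{i..<k}" and ?N = "mark_mset k N"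
  let ?G = "G_marked k i N" and ?E = "E_marked k i N" and ?D = "D_set (N 1)"
  \<comment> \<open>Adding \<open>(N 1)^2\<close> on both sides makes all weights natural numbers,
    as the fibre lemma requires.\<close>
  let ?e = "\<lambda>\<eta>. nat ((int ?n)\<^sup>2 + sum_list \<eta>)"
  let ?f = "\<lambda>\<mu>. weight \<mu> + ?n\<^sup>2" and ?g = "\<lambda>(\<eta>, \<nu>). ?e \<eta> + weight \<nu>"
  note G = G_marked_eq_conts[OF assms(1,2), of N] and E = E_marked_eq_conts[OF assms(1,2), of N]
  \<comment> \<open>For \<open>k = 1\<close> the multiset is empty, and \<open>N 1 = 0\<close> by
    assumption.\<close>
  have n: "count ?N 1 = ?n" using assms by (auto simp: count_mark_mset)
  \<comment> \<open>If 1 is blocked, then \<open>i = 1\<close> and all marks below \<open>k\<close>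
    are blocked, so the next mark is not among those to be placed. Hence \<open>defect_full\<close>
    has no extra summand here.\<close>
  have no: "\<not> (1 \<in> ?A \<and> least_unused ?A \<in># ?N)"
  proof
    assume "1 \<in> ?A \<and> least_unused ?A \<in># ?N"
    then have "least_unused ?A < k" "1 \<in> ?A" using set_mark_mset[of k N] by auto
    moreover have "least_unused ?A \<notin> ?A" "1 \<le> least_unused ?A" using least_unused_props[of ?A] by blast+
    ultimately show False by auto
  qed
  have key: "fps_X ^ ?n\<^sup>2 * weight_gf ?G = gg.odd_prod ?n * weight_gf ?E"
    using gg.defect_full_eq_0[of ?A ?N] unfolding gg.defect_full_def G E n if_not_P[OF no] by simp
  have finG: "finite {\<mu> \<in> ?G. weight \<mu> = m}" for m
    unfolding G by (rule finite_weight_fibre[OF conts_overpartition(1)])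
  have finE: "finite {\<nu> \<in> ?E. weight \<nu> = m}" for m
    unfolding E by (rule finite_weight_fibre[OF conts_overpartition(1)])
  have nth: "card {l \<in> S. weight l + a = m} = fps_nth (fps_X ^ a * weight_gf S) m" for S a m
  proof -
    have "{l \<in> S. weight l + a = m} = (if m < a then {} else {l \<in> S. weight l = m - a})" by auto
    then show ?thesis by (simp add: weight_gf_def fps_X_power_mult_nth)
  qed
  have pairs: "{p \<in> ?D \<times> ?E. ?g p = m} = Sigma ?D (\<lambda>\<eta>. {\<nu> \<in> ?E. weight \<nu> + ?e \<eta> = m})" for m by auto
  have finE': "finite {\<nu> \<in> ?E. weight \<nu> + a = m}" for a m
    by (rule finite_subset[OF _ finE[of "m - a"]]) auto
  have "\<exists>h. bij_betw h ?G (?D \<times> ?E) \<and> (\<forall>\<mu>\<in>?G. ?g (h \<mu>) = ?f \<mu>)"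
  proof (rule bij_betw_of_equal_fibres)
    fix m
    show "finite {\<mu> \<in> ?G. ?f \<mu> = m}"
      by (rule finite_subset[OF _ finG[of "m - ?n\<^sup>2"]]) auto
    show "finite {p \<in> ?D \<times> ?E. ?g p = m}"
      unfolding pairs by (intro finite_SigmaI finite_D_set finE')
    have "int (card {p \<in> ?D \<times> ?E. ?g p = m}) = (\<Sum>\<eta>\<in>?D. int (card {\<nu> \<in> ?E. weight \<nu> + ?e \<eta> = m}))"
      unfolding pairs using finite_D_set finE' by (subst card_SigmaI) auto
    also have "\<dots> = fps_nth ((\<Sum>\<eta>\<in>?D. fps_X ^ ?e \<eta>) * weight_gf ?E) m"
      unfolding nth sum_distrib_right by (simp add: fps_sum_nth)
    also have "\<dots> = int (card {\<mu> \<in> ?G. ?f \<mu> = m})"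
      unfolding nth key D_set_gf ..
    finally show "card {\<mu> \<in> ?G. ?f \<mu> = m} = card {p \<in> ?D \<times> ?E. ?g p = m}" by simp
  qed
  then obtain h where h: "bij_betw h ?G (?D \<times> ?E)" "\<And>\<mu>. \<mu> \<in> ?G \<Longrightarrow> ?g (h \<mu>) = ?f \<mu>" by blast
  have "int (weight \<mu>) = sum_list \<eta> + int (weight \<nu>)" if "\<mu> \<in> ?G" "h \<mu> = (\<eta>, \<nu>)" for \<mu> \<eta> \<nu>
  proof -
    have "\<eta> \<in> ?D" using bij_betwE[OF h(1)] that by force
    then have "int (?e \<eta>) = (int ?n)\<^sup>2 + sum_list \<eta>" using D_set_sum_ge by simp
    moreover have "?e \<eta> + weight \<nu> = weight \<mu> + ?n\<^sup>2"
      using h(2)[OF that(1)] unfolding that(2) prod.case .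
    then have "int (?e \<eta>) + int (weight \<nu>) = int (weight \<mu>) + (int ?n)\<^sup>2"
      by (simp only: of_nat_add[symmetric] of_nat_power[symmetric])
    ultimately show ?thesis by simp
  qed
  then show ?thesis using h(1) by blast
qed

end
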